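(* Let $P_1$ and $P_2$ be $\mathcal{S}$-pregroups. If $P_1\equiv_\exists P_2$ with respect to the language $\mathcal{L}^{\mathrm{pre}}_\mathcal{S}$, then $U(P_1)\equiv_\exists U(P_2)$ with respect to the language $\mathcal{L}_\mathcal{S}$.
   Context: A pregroup is a set $P$ with a distinguished element $1$, a map $x\mapsto x^{-1}$, a binary relation $D\subseteq P\times P$ and a ternary relation $M\subseteq P^3$ satisfying, for all elements of $P$: (i) $(x,y,z)\in M\Rightarrow(x,y)\in D$; (ii) $(x,y)\in D\Rightarrow\exists z\,(x,y,z)\in M$; (iii) $(w,x,y),(w,x,z)\in M\Rightarrow y=z$; (iv) $(x,1,x),(1,x,x)\in M$; (v) $(x,x^{-1},1),(x^{-1},x,1)\in M$; (vi) $(x,y,z)\in M\Rightarrow(y^{-1},x^{-1},z^{-1})\in M$; (vii) if $(a,b,r),(b,c,s)\in M$ then for all $x$, $(a,s,x)\in M\iff(r,c,x)\in M$; (viii) if $(a,b,x),(b,c,y),(c,d,z)\in M$ then $\exists r\,(a,y,r)\in M$ or $\exists s\,(y,d,s)\in M$. For $(a,b)\in D$, $ab$ is the unique $c$ with $(a,b,c)\in M$. A word over $P$ is a finite sequence of elements of $P$; it is reduced if no two consecutive entries $c_i,c_{i+1}$ satisfy $(c_i,c_{i+1})\in D$. For words $\mathbf c=(c_1,\dots,c_k)$, $\mathbf a=(a_1,\dots,a_{k-1})$, with $a_0=a_k=1$, if $(a_{i-1}^{-1},c_i)\in D$ and $(a_{i-1}^{-1}c_i,a_i)\in D$ for all $i$,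 the interleaving $\mathbf c*\mathbf a=(d_1,\dots,d_k)$ has $d_i=(a_{i-1}^{-1}c_i)a_i$; $\mathbf c\approx\mathbf d$ means $\mathbf d=\mathbf c*\mathbf a$ for some $\mathbf a$. The universal group $U(P)$ (Stallings) is the set of $\approx$-classes of reduced words, with product given by concatenation followed by reduction (replacing adjacent $c_i,c_{i+1}$ with $(c_i,c_{i+1})\in D$ by $c_ic_{i+1}$) to a reduced word; $P$ embeds in $U(P)$ via one-letter words. Let $\mathcal{S}$ be a set of sets $K$, each $K$ a subset containing $1$ of some fixed pregroup. The language $\mathcal{L}^{\mathrm{pre}}_\mathcal{S}$ has constants $1$ and $d^K_k$ ($k\in K$, $K\in\mathcal{S}$), unary function $^{-1}$, relations $D$ (binary), $M$ (ternary), and a unary predicate $\delta_\mathcal{S}$; an $\mathcal{S}$-pregroup is an $\mathcal{L}^{\mathrm{pre}}_\mathcal{S}$-structure that is a pregroup, satisfies all closed atomic formulas and their negations true in each $K$ (its diagram), and satisfies $d^K_k\in\delta_\mathcal{S}$ and $\forall x(x\notin\delta_\mathcal{S}\rightarrow x\neq d^K_k)$ for all $k\in K$, $K\in\mathcal{S}$. The language $\mathcal{L}_\mathcal{S}$ has the constants $d^K_k$, binary $\cdot$, unary $^{-1}$ and unary predicate $\delta_\mathcal{S}$; $U(P)$ of an $\mathcal{S}$-pregroup $P$ is regarded as an $\mathcal{L}_\mathcal{S}$-structure (an $\mathcal{S}$-group) with constants and $\delta_\mathcal{S}$ interpreted via $P\subseteq U(P)$. $\equiv_\exists$ means satisfying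 the same existential sentences of the indicated language. *)

theory Defs
  imports Main
begin

record 'a pregroup =
  pcarrier :: "'a set"
  pone :: 'a
  pinv :: "'a \<Rightarrow> 'a"
  pD :: "'a \<Rightarrow> 'a \<Rightarrow> bool"
  pM :: "'a \<Rightarrow> 'a \<Rightarrow> 'a \<Rightarrow> bool"

definition pregroup :: "('a, 'x) pregroup_scheme \<Rightarrow> bool" where
  "pregroup P \<longleftrightarrow>
     (let C = pcarrier P; one = pone P; inv = pinv P; D = pD P; M = pM P in
      one \<in> C \<and> (\<forall>x\<in>C. inv x \<in> C) \<and>
      (\<forall>x y. D x y \<longrightarrow> x \<in> C \<and> y \<in> C) \<and>
      (\<forall>x y z. M x y z \<longrightarrow> x \<in> C \<and> y \<in> C \<and> z \<in> C) \<and>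
      \<comment> \<open>(i)\<close>
      (\<forall>x\<in>C. \<forall>y\<in>C. \<forall>z\<in>C. M x y z \<longrightarrow> D x y) \<and>
      \<comment> \<open>(ii)\<close>
      (\<forall>x\<in>C. \<forall>y\<in>C. D x y \<longrightarrow> (\<exists>z\<in>C. M x y z)) \<and>
      \<comment> \<open>(iii)\<close>
      (\<forall>w\<in>C. \<forall>x\<in>C. \<forall>y\<in>C. \<forall>z\<in>C. M w x y \<and> M w x z \<longrightarrow> y = z) \<and>
      \<comment> \<open>(iv)\<close>
      (\<forall>x\<in>C. M x one x \<and> M one x x) \<and>
      \<comment> \<open>(v)\<close>
      (\<forall>x\<in>C. M x (inv x) one \<and> M (inv x) x one) \<and>
      \<comment> \<open>(vi)\<close>
      (\<forall>x\<in>C. \<forall>y\<in>C. \<forall>z\<in>C. M x y z \<longrightarrow> M (inv y) (inv x) (inv z)) \<and>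
      \<comment> \<open>(vii)\<close>
      (\<forall>a\<in>C. \<forall>b\<in>C. \<forall>c\<in>C. \<forall>r\<in>C. \<forall>s\<in>C. M a b r \<and> M b c s \<longrightarrow>
          (\<forall>x\<in>C. M a s x \<longleftrightarrow> M r c x)) \<and>
      \<comment> \<open>(viii)\<close>
      (\<forall>a\<in>C. \<forall>b\<in>C. \<forall>c\<in>C. \<forall>d\<in>C. \<forall>x\<in>C. \<forall>y\<in>C. \<forall>z\<in>C.
          M a b x \<and> M b c y \<and> M c d z \<longrightarrow> (\<exists>r\<in>C. M a y r) \<or> (\<exists>s\<in>C. M y d s)))"

text \<open>The product ab for (a,b) in D.\<close>
definition pmul :: "('a, 'x) pregroup_scheme \<Rightarrow> 'a \<Rightarrow> 'a \<Rightarrow> 'a" where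
  "pmul P x y = (THE z. pM P x y z)"

definition pword :: "('a, 'x) pregroup_scheme \<Rightarrow> 'a list \<Rightarrow> bool" where
  "pword P w \<longleftrightarrow> set w \<subseteq> pcarrier P"

definition reduced :: "('a, 'x) pregroup_scheme \<Rightarrow> 'a list \<Rightarrow> bool" where
  "reduced P w \<longleftrightarrow> (\<forall>i. Suc i < length w \<longrightarrow> \<not> pD P (w ! i) (w ! Suc i))"

definition red_step :: "('a, 'x) pregroup_scheme \<Rightarrow> 'a list \<Rightarrow> 'a list \<Rightarrow> bool" where
  "red_step P u v \<longleftrightarrow> (\<exists>xs a b ys. u = xs @ [a, b] @ ys \<and> pD P a b \<and> v = xs @ [pmul P a b] @ ys)"

text \<open>Interleaving (0-indexed): the word a has length k-1 and a_0 = a_k = 1.\<close>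
definition ilv_a :: "('a, 'x) pregroup_scheme \<Rightarrow> nat \<Rightarrow> 'a list \<Rightarrow> nat \<Rightarrow> 'a" where
  "ilv_a P k a j = (if j = 0 \<or> j = k then pone P else a ! (j - 1))"

definition interleave_ok :: "('a, 'x) pregroup_scheme \<Rightarrow> 'a list \<Rightarrow> 'a list \<Rightarrow> bool" where
  "interleave_ok P c a \<longleftrightarrow>
     length a + 1 = length c \<and> pword P a \<and>
     (\<forall>j < length c.
        pD P (pinv P (ilv_a P (length c) a j)) (c ! j) \<and>
        pD P (pmul P (pinv P (ilv_a P (length c) a j)) (c ! j)) (ilv_a P (length c) a (Suc j)))"

definition interleave :: "('a, 'x) pregroup_scheme \<Rightarrow> 'a list \<Rightarrow> 'a list \<Rightarrow> 'a list" where
  "interleave P c a =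
     map (\<lambda>j. pmul P (pmul P (pinv P (ilv_a P (length c) a j)) (c ! j)) (ilv_a P (length c) a (Suc j)))
         [0..<length c]"

definition approx :: "('a, 'x) pregroup_scheme \<Rightarrow> 'a list \<Rightarrow> 'a list \<Rightarrow> bool" where
  "approx P c d \<longleftrightarrow> (\<exists>a. interleave_ok P c a \<and> d = interleave P c a)"

definition wcls :: "('a, 'x) pregroup_scheme \<Rightarrow> 'a list \<Rightarrow> 'a list set" where
  "wcls P c = {d. approx P c d}"

text \<open>Elements of U(P): approx-classes of (nonempty) reduced words; the identity is the
  class of the one-letter word [1].\<close>
definition Ucarrier :: "('a, 'x) pregroup_scheme \<Rightarrow> 'a list set set" where
  "Ucarrier P = {wcls P c | c. pword P c \<and> c \<noteq> [] \<and> reduced P c}"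

definition Umul :: "('a, 'x) pregroup_scheme \<Rightarrow> 'a list set \<Rightarrow> 'a list set \<Rightarrow> 'a list set" where
  "Umul P X Y = (SOME Z. \<exists>u\<in>X. \<exists>v\<in>Y. \<exists>w. reduced P w \<and> (red_step P)\<^sup>*\<^sup>* (u @ v) w \<and> Z = wcls P w)"

definition Uone :: "('a, 'x) pregroup_scheme \<Rightarrow> 'a list set" where
  "Uone P = wcls P [pone P]"

definition Uinv :: "('a, 'x) pregroup_scheme \<Rightarrow> 'a list set \<Rightarrow> 'a list set" where
  "Uinv P X = (SOME Y. Y \<in> Ucarrier P \<and> Umul P X Y = Uone P \<and> Umul P Y X = Uone P)"

record ('a, 'c) spre = "'a pregroup" +
  sconst :: "'c \<Rightarrow> 'a"
  sdelta :: "'a set"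

record ('u, 'c) sgroup =
  gcarrier :: "'u set"
  gmul :: "'u \<Rightarrow> 'u \<Rightarrow> 'u"
  ginv :: "'u \<Rightarrow> 'u"
  gconst :: "'c \<Rightarrow> 'u"
  gdelta :: "'u set"

text \<open>Constant symbols d^K_k are the pairs (K,k) with K in S, k in K.\<close>
definition Syms :: "'q set set \<Rightarrow> ('q set \<times> 'q) set" where
  "Syms S = {(K, k). K \<in> S \<and> k \<in> K}"

datatype 'c pterm = PVar nat | POne | PConst 'c | PInv "'c pterm"

datatype 'c pform =
    PEq "'c pterm" "'c pterm" | PDrel "'c pterm" "'c pterm"
  | PMrel "'c pterm" "'c pterm" "'c pterm" | PDelta "'c pterm"
  | PNot "'c pform" | PAnd "'c pform" "'c pform" | POr "'c pform" "'c pform"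

primrec pt_vars :: "'c pterm \<Rightarrow> nat set" where
  "pt_vars (PVar n) = {n}" | "pt_vars POne = {}" | "pt_vars (PConst c) = {}"
| "pt_vars (PInv t) = pt_vars t"

primrec pt_consts :: "'c pterm \<Rightarrow> 'c set" where
  "pt_consts (PVar n) = {}" | "pt_consts POne = {}" | "pt_consts (PConst c) = {c}"
| "pt_consts (PInv t) = pt_consts t"

primrec pf_vars :: "'c pform \<Rightarrow> nat set" where
  "pf_vars (PEq s t) = pt_vars s \<union> pt_vars t"
| "pf_vars (PDrel s t) = pt_vars s \<union> pt_vars t"
| "pf_vars (PMrel s t u) = pt_vars s \<union> pt_vars t \<union> pt_vars u"
| "pf_vars (PDelta t) = pt_vars t"
| "pf_vars (PNot f) = pf_vars f"
| "pf_vars (PAnd f g) = pf_vars f \<union> pf_vars g"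
| "pf_vars (POr f g) = pf_vars f \<union> pf_vars g"

primrec pf_consts :: "'c pform \<Rightarrow> 'c set" where
  "pf_consts (PEq s t) = pt_consts s \<union> pt_consts t"
| "pf_consts (PDrel s t) = pt_consts s \<union> pt_consts t"
| "pf_consts (PMrel s t u) = pt_consts s \<union> pt_consts t \<union> pt_consts u"
| "pf_consts (PDelta t) = pt_consts t"
| "pf_consts (PNot f) = pf_consts f"
| "pf_consts (PAnd f g) = pf_consts f \<union> pf_consts g"
| "pf_consts (POr f g) = pf_consts f \<union> pf_consts g"

primrec pt_eval :: "('a, 'c, 'x) spre_scheme \<Rightarrow> (nat \<Rightarrow> 'a) \<Rightarrow> 'c pterm \<Rightarrow> 'a" where
  "pt_eval P \<rho> (PVar n) = \<rho> n"
| "pt_eval P \<rho> POne = pone P"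
| "pt_eval P \<rho> (PConst c) = sconst P c"
| "pt_eval P \<rho> (PInv t) = pinv P (pt_eval P \<rho> t)"

primrec pf_sat :: "('a, 'c, 'x) spre_scheme \<Rightarrow> (nat \<Rightarrow> 'a) \<Rightarrow> 'c pform \<Rightarrow> bool" where
  "pf_sat P \<rho> (PEq s t) = (pt_eval P \<rho> s = pt_eval P \<rho> t)"
| "pf_sat P \<rho> (PDrel s t) = pD P (pt_eval P \<rho> s) (pt_eval P \<rho> t)"
| "pf_sat P \<rho> (PMrel s t u) = pM P (pt_eval P \<rho> s) (pt_eval P \<rho> t) (pt_eval P \<rho> u)"
| "pf_sat P \<rho> (PDelta t) = (pt_eval P \<rho> t \<in> sdelta P)"
| "pf_sat P \<rho> (PNot f) = (\<not> pf_sat P \<rho> f)"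
| "pf_sat P \<rho> (PAnd f g) = (pf_sat P \<rho> f \<and> pf_sat P \<rho> g)"
| "pf_sat P \<rho> (POr f g) = (pf_sat P \<rho> f \<or> pf_sat P \<rho> g)"

primrec pf_atomic_nodelta :: "'c pform \<Rightarrow> bool" where
  "pf_atomic_nodelta (PEq s t) = True"
| "pf_atomic_nodelta (PDrel s t) = True"
| "pf_atomic_nodelta (PMrel s t u) = True"
| "pf_atomic_nodelta (PDelta t) = False"
| "pf_atomic_nodelta (PNot f) = False"
| "pf_atomic_nodelta (PAnd f g) = False"
| "pf_atomic_nodelta (POr f g) = False"

text \<open>The existential sentence \<exists>x_0 ... x_{n-1}. phi (phi quantifier-free).\<close>
definition pre_ex_sat :: "('a, 'c, 'x) spre_scheme \<Rightarrow> nat \<Rightarrow> 'c pform \<Rightarrow> bool" where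
  "pre_ex_sat P n \<phi> \<longleftrightarrow> (\<exists>\<rho>. \<rho> ` {..<n} \<subseteq> pcarrier P \<and> pf_sat P \<rho> \<phi>)"

definition pre_ex_equiv :: "'q set set \<Rightarrow> ('a, 'q set \<times> 'q) spre \<Rightarrow> ('b, 'q set \<times> 'q) spre \<Rightarrow> bool" where
  "pre_ex_equiv S P1 P2 \<longleftrightarrow>
     (\<forall>n \<phi>. pf_vars \<phi> \<subseteq> {..<n} \<and> pf_consts \<phi> \<subseteq> Syms S \<longrightarrow>
        (pre_ex_sat P1 n \<phi> \<longleftrightarrow> pre_ex_sat P2 n \<phi>))"

definition Qexp :: "'q pregroup \<Rightarrow> ('q, 'q set \<times> 'q) spre" where
  "Qexp Q = \<lparr>pcarrier = pcarrier Q, pone = pone Q, pinv = pinv Q, pD = pD Q, pM = pM Q,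
             sconst = snd, sdelta = {}\<rparr>"

definition spregroup :: "'q pregroup \<Rightarrow> 'q set set \<Rightarrow> ('a, 'q set \<times> 'q) spre \<Rightarrow> bool" where
  "spregroup Q S P \<longleftrightarrow>
     pregroup P \<and> sdelta P \<subseteq> pcarrier P \<and>
     (\<forall>c\<in>Syms S. sconst P c \<in> pcarrier P) \<and>
     \<comment> \<open>diagram of each K: closed atomic sentences with constants from K, and their negations\<close>
     (\<forall>K\<in>S. \<forall>\<phi>. pf_atomic_nodelta \<phi> \<and> pf_vars \<phi> = {} \<and> pf_consts \<phi> \<subseteq> {K} \<times> K \<longrightarrow>
        (\<forall>\<rho> \<rho>'. pf_sat P \<rho> \<phi> \<longleftrightarrow> pf_sat (Qexp Q) \<rho>' \<phi>)) \<and>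
     (\<forall>c\<in>Syms S. sconst P c \<in> sdelta P \<and> (\<forall>x\<in>pcarrier P. x \<notin> sdelta P \<longrightarrow> x \<noteq> sconst P c))"

datatype 'c gterm = GVar nat | GConst 'c | GMul "'c gterm" "'c gterm" | GInv "'c gterm"

datatype 'c gform =
    GEq "'c gterm" "'c gterm" | GDelta "'c gterm"
  | GNot "'c gform" | GAnd "'c gform" "'c gform" | GOr "'c gform" "'c gform"

primrec gt_vars :: "'c gterm \<Rightarrow> nat set" where
  "gt_vars (GVar n) = {n}" | "gt_vars (GConst c) = {}"
| "gt_vars (GMul s t) = gt_vars s \<union> gt_vars t" | "gt_vars (GInv t) = gt_vars t"

primrec gt_consts :: "'c gterm \<Rightarrow> 'c set" where
  "gt_consts (GVar n) = {}" | "gt_consts (GConst c) = {c}"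
| "gt_consts (GMul s t) = gt_consts s \<union> gt_consts t" | "gt_consts (GInv t) = gt_consts t"

primrec gf_vars :: "'c gform \<Rightarrow> nat set" where
  "gf_vars (GEq s t) = gt_vars s \<union> gt_vars t" | "gf_vars (GDelta t) = gt_vars t"
| "gf_vars (GNot f) = gf_vars f" | "gf_vars (GAnd f g) = gf_vars f \<union> gf_vars g"
| "gf_vars (GOr f g) = gf_vars f \<union> gf_vars g"

primrec gf_consts :: "'c gform \<Rightarrow> 'c set" where
  "gf_consts (GEq s t) = gt_consts s \<union> gt_consts t" | "gf_consts (GDelta t) = gt_consts t"
| "gf_consts (GNot f) = gf_consts f" | "gf_consts (GAnd f g) = gf_consts f \<union> gf_consts g"
| "gf_consts (GOr f g) = gf_consts f \<union> gf_consts g"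

primrec gt_eval :: "('u, 'c) sgroup \<Rightarrow> (nat \<Rightarrow> 'u) \<Rightarrow> 'c gterm \<Rightarrow> 'u" where
  "gt_eval G \<rho> (GVar n) = \<rho> n"
| "gt_eval G \<rho> (GConst c) = gconst G c"
| "gt_eval G \<rho> (GMul s t) = gmul G (gt_eval G \<rho> s) (gt_eval G \<rho> t)"
| "gt_eval G \<rho> (GInv t) = ginv G (gt_eval G \<rho> t)"

primrec gf_sat :: "('u, 'c) sgroup \<Rightarrow> (nat \<Rightarrow> 'u) \<Rightarrow> 'c gform \<Rightarrow> bool" where
  "gf_sat G \<rho> (GEq s t) = (gt_eval G \<rho> s = gt_eval G \<rho> t)"
| "gf_sat G \<rho> (GDelta t) = (gt_eval G \<rho> t \<in> gdelta G)"
| "gf_sat G \<rho> (GNot f) = (\<not> gf_sat G \<rho> f)"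
| "gf_sat G \<rho> (GAnd f g) = (gf_sat G \<rho> f \<and> gf_sat G \<rho> g)"
| "gf_sat G \<rho> (GOr f g) = (gf_sat G \<rho> f \<or> gf_sat G \<rho> g)"

definition grp_ex_sat :: "('u, 'c) sgroup \<Rightarrow> nat \<Rightarrow> 'c gform \<Rightarrow> bool" where
  "grp_ex_sat G n \<phi> \<longleftrightarrow> (\<exists>\<rho>. \<rho> ` {..<n} \<subseteq> gcarrier G \<and> gf_sat G \<rho> \<phi>)"

definition grp_ex_equiv :: "'q set set \<Rightarrow> ('u, 'q set \<times> 'q) sgroup \<Rightarrow> ('v, 'q set \<times> 'q) sgroup \<Rightarrow> bool" where
  "grp_ex_equiv S G1 G2 \<longleftrightarrow>
     (\<forall>n \<phi>. gf_vars \<phi> \<subseteq> {..<n} \<and> gf_consts \<phi> \<subseteq> Syms S \<longrightarrow>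
        (grp_ex_sat G1 n \<phi> \<longleftrightarrow> grp_ex_sat G2 n \<phi>))"

definition Ugroup :: "('a, 'c) spre \<Rightarrow> ('a list set, 'c) sgroup" where
  "Ugroup P = \<lparr>gcarrier = Ucarrier P, gmul = Umul P, ginv = Uinv P,
               gconst = (\<lambda>c. wcls P [sconst P c]),
               gdelta = {wcls P [x] | x. x \<in> sdelta P}\<rparr>"

end

theory Submission
  imports Defs
begin

text \<open>
  Call two words over a pregroup related by an elementary move if one arises from the other by
  replacing adjacent letters \<open>x, y\<close> by \<open>xa, a\<^sup>-\<^sup>1y\<close>. Reduction is locally confluent and locally
  coherent modulo elementary moves: the overlap of \<open>ab\<close> and \<open>bc\<close> in \<open>a, b, c\<close> yields \<open>ab, c\<close> and
  \<open>a, bc\<close>, which differ by a move, and axiom (viii) settles the overlap of a move with a reduction.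
  Since reduction shortens words, reduced forms are unique up to moves, that is, up to interleaving.
  Hence \<open>U(P)\<close> is the group of nonempty words modulo the equivalence generated by reduction.

  An equation \<open>s = t\<close> holds in \<open>U(P)\<close> iff the word of \<open>st\<^sup>-\<^sup>1\<close> reduces to the one-letter word \<open>1\<close>, and
  \<open>t \<in> \<delta>\<close> holds iff the word of \<open>t\<close> reduces to a single letter from \<open>\<delta>\<close>. For a given assignment,
  a quantifier-free formula over \<open>U(P\<^sub>1)\<close> thus depends only on finitely many reductions, and these
  involve a finite set \<open>F\<close> of letters. The atomic diagram of \<open>F\<close> is an existential statement, so it is
  realised in \<open>P\<^sub>2\<close>; the resulting map on letters carries reductions to reductions and reduced words
  to reduced words, also when these are not equal to \<open>1\<close>, so it preserves negated atoms as well.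
\<close>

section \<open>Reduction modulo elementary moves\<close>

text \<open>Bookkeeping for critical pairs: comparing the lengths of the two prefixes decides
  whether the pairs coincide, share one letter or are disjoint.\<close>

lemma adjacent_pairs_cases:
  assumes "xs @ a # b # ys = xs' @ a' # b' # ys'"
  obtains (same) "xs' = xs" "a' = a" "b' = b" "ys' = ys"
  | (overlap_right) "xs' = xs @ [a]" "a' = b" "ys = b' # ys'"
  | (overlap_left) "xs = xs' @ [a']" "a = b'" "ys' = b # ys"
  | (right) zs where "xs' = xs @ a # b # zs" "ys = zs @ a' # b' # ys'"
  | (left) zs where "xs = xs' @ a' # b' # zs" "ys' = zs @ a # b # ys"
proof -
  from assms consider
      (A) us where "xs = xs' @ us" "us @ a # b # ys = a' # b' # ys'"
    | (B) us where "xs' = xs @ us" "a # b # ys = us @ a' # b' # ys'"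
    by (auto simp: append_eq_append_conv2)
  then show thesis
  proof cases
    case (A us)
    consider "us = []" | u where "us = [u]" | u v zs where "us = u # v # zs"
      by (metis list.exhaust)
    then show ?thesis
      by cases (use A same in simp, use A overlap_left in simp, use A left in simp)
  next
    case (B us)
    consider "us = []" | u where "us = [u]" | u v zs where "us = u # v # zs"
      by (metis list.exhaust)
    then show ?thesis
      by cases (use B same in simp, use B overlap_right in simp, use B right in simp)
  qed
qed

section \<open>Calculus of the partial product in a pregroup\<close>

locale pregroup_struct =
  fixes P :: "('a, 'x) pregroup_scheme"
  assumes pregroup_P: "pregroup P"
begin

abbreviation "C \<equiv> pcarrier P"
abbreviation "D \<equiv> pD P"
abbreviation "M \<equiv> pM P"
abbreviation "\<i> \<equiv> pinv P"
abbreviation "\<e> \<equiv> pone P"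

lemma pregroup_axioms:
  shows "\<e> \<in> C" and "\<forall>x\<in>C. \<i> x \<in> C"
    and "\<forall>x y z. M x y z \<longrightarrow> x \<in> C \<and> y \<in> C \<and> z \<in> C"
    and "\<forall>x y. D x y \<longrightarrow> x \<in> C \<and> y \<in> C"
    and "\<forall>x\<in>C. \<forall>y\<in>C. \<forall>z\<in>C. M x y z \<longrightarrow> D x y"
    and "\<forall>x\<in>C. \<forall>y\<in>C. D x y \<longrightarrow> (\<exists>z\<in>C. M x y z)"
    and "\<forall>w\<in>C. \<forall>x\<in>C. \<forall>y\<in>C. \<forall>z\<in>C. M w x y \<and> M w x z \<longrightarrow> y = z"
    and "\<forall>x\<in>C. M x \<e> x \<and> M \<e> x x"
    and "\<forall>x\<in>C. M x (\<i> x) \<e> \<and> M (\<i> x) x \<e>"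
    and "\<forall>x\<in>C. \<forall>y\<in>C. \<forall>z\<in>C. M x y z \<longrightarrow> M (\<i> y) (\<i> x) (\<i> z)"
    and "\<forall>a\<in>C. \<forall>b\<in>C. \<forall>c\<in>C. \<forall>r\<in>C. \<forall>s\<in>C. M a b r \<and> M b c s \<longrightarrow>
           (\<forall>x\<in>C. M a s x \<longleftrightarrow> M r c x)"
    and "\<forall>a\<in>C. \<forall>b\<in>C. \<forall>c\<in>C. \<forall>d\<in>C. \<forall>x\<in>C. \<forall>y\<in>C. \<forall>z\<in>C.
           M a b x \<and> M b c y \<and> M c d z \<longrightarrow> (\<exists>r\<in>C. M a y r) \<or> (\<exists>s\<in>C. M y d s)"
  using pregroup_P[unfolded pregroup_def Let_def] by - (elim conjE, assumption)+

lemma M_closed: "M x y z \<Longrightarrow> x \<in> C" "M x y z \<Longrightarrow> y \<in> C" "M x y z \<Longrightarrow> z \<in> C"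
  using pregroup_axioms(3) by blast+

lemma D_iff: "D x y \<longleftrightarrow> (\<exists>z. M x y z)"
  using pregroup_axioms(3-6) by blast

lemma M_unique: "M x y z \<Longrightarrow> M x y z' \<Longrightarrow> z = z'"
  using pregroup_axioms(7) M_closed by blast

lemma one_closed: "\<e> \<in> C"
  by (rule pregroup_axioms(1))

lemma inv_closed: "x \<in> C \<Longrightarrow> \<i> x \<in> C"
  using pregroup_axioms(2) by blast

lemma M_one: "x \<in> C \<Longrightarrow> M x \<e> x" "x \<in> C \<Longrightarrow> M \<e> x x"
  using pregroup_axioms(8) by blast+

lemma M_inverse: "x \<in> C \<Longrightarrow> M x (\<i> x) \<e>" "x \<in> C \<Longrightarrow> M (\<i> x) x \<e>"
  using pregroup_axioms(9) by blast+

lemma M_assoc: "M a b r \<Longrightarrow> M b c s \<Longrightarrow> M a s x \<longleftrightarrow> M r c x"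
  using pregroup_axioms(11) M_closed by meson

lemma M_inv_rev: "M x y z \<Longrightarrow> M (\<i> y) (\<i> x) (\<i> z)"
  using pregroup_axioms(10) M_closed by meson

lemma M_four: "M a b x \<Longrightarrow> M b c y \<Longrightarrow> M c d z \<Longrightarrow> (\<exists>r. M a y r) \<or> (\<exists>s. M y d s)"
  using pregroup_axioms(12) M_closed by meson

lemma pmul_eq: "M x y z \<Longrightarrow> pmul P x y = z"
  unfolding pmul_def by (blast intro: M_unique)

text \<open>Axiom (vii) for the triple a^-1, a, b: the product a^-1 r exists and has the same value
  as 1 b, which is b.\<close>

lemma M_cancel_left: "M a b r \<Longrightarrow> M (\<i> a) r b"
  using M_assoc[OF M_inverse(2) , of a b r] M_one(2) M_closed by blast

lemma M_cancel_right: "M a b r \<Longrightarrow> M r (\<i> b) a"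
  using M_assoc[OF _ M_inverse(1), of a b r] M_one(1) M_closed by blast

lemma inv_inv: "a \<in> C \<Longrightarrow> \<i> (\<i> a) = a"
  using M_cancel_left[OF M_inverse(2)] M_one(1) M_unique inv_closed by metis

lemma inv_one: "\<i> \<e> = \<e>"
  using M_inverse(1)[OF one_closed] M_one(2) M_unique inv_closed one_closed by metis

section \<open>One-step reductions and normal forms\<close>

lemma red_step_iff:
  "red_step P u v \<longleftrightarrow> (\<exists>xs a b c ys. M a b c \<and> u = xs @ a # b # ys \<and> v = xs @ c # ys)"
  unfolding red_step_def D_iff by simp (metis pmul_eq)

lemma red_stepI: "M a b c \<Longrightarrow> red_step P (xs @ a # b # ys) (xs @ c # ys)"
  unfolding red_step_iff by blast

lemma red_step_length: "red_step P u v \<Longrightarrow> length u = Suc (length v)"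
  by (auto simp: red_step_iff)

lemma red_step_context: "red_step P u v \<Longrightarrow> red_step P (xs @ u @ ys) (xs @ v @ ys)"
  unfolding red_step_iff by (metis append.assoc append_Cons)

lemma not_reduced_iff: "\<not> reduced P u \<longleftrightarrow> (\<exists>v. red_step P u v)"
proof
  assume "\<not> reduced P u"
  then obtain i where i: "Suc i < length u" "D (u ! i) (u ! Suc i)"
    by (auto simp: reduced_def)
  then obtain z where "M (u ! i) (u ! Suc i) z" by (auto simp: D_iff)
  moreover have "u = take i u @ u ! i # u ! Suc i # drop (Suc (Suc i)) u"
    using i by (metis Cons_nth_drop_Suc Suc_lessD append_take_drop_id)
  ultimately show "\<exists>v. red_step P u v" by (metis red_stepI)
next
  assume "\<exists>v. red_step P u v"
  then obtain xs a b c ys where "M a b c" and u: "u = xs @ a # b # ys"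
    by (auto simp: red_step_iff)
  then have "Suc (length xs) < length u" "D (u ! length xs) (u ! Suc (length xs))"
    by (auto simp: nth_append D_iff)
  then show "\<not> reduced P u" by (auto simp: reduced_def)
qed

text \<open>A relation and not a function, because normal forms are determined only up to elementary
  moves.\<close>

definition normal_form :: "'a list \<Rightarrow> 'a list \<Rightarrow> bool" where
  "normal_form u w \<longleftrightarrow> (red_step P)\<^sup>*\<^sup>* u w \<and> reduced P w"

lemma normal_form_exists: "\<exists>w. normal_form u w"
proof (induction u rule: length_induct)
  case (1 u)
  show ?case
  proof (cases "reduced P u")
    case True
    then show ?thesis by (auto simp: normal_form_def)
  next
    case False
    then obtain v where v: "red_step P u v" by (auto simp: not_reduced_iff)
    then obtain w where "normal_form v w" using 1 red_step_length by force
    then show ?thesis using v by (auto simp: normal_form_def intro: converse_rtranclp_into_rtranclp)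
  qed
qed

lemma normal_form_cases:
  assumes "normal_form u w"
  obtains "w = u" "reduced P u" | v where "red_step P u v" "normal_form v w"
  using assms unfolding normal_form_def by (metis converse_rtranclpE)

lemma normal_form_step: "red_step P u v \<Longrightarrow> normal_form v w \<Longrightarrow> normal_form u w"
  by (auto simp: normal_form_def intro: converse_rtranclp_into_rtranclp)

text \<open>The interleaving in which at most one interior entry, \<open>a\<close>, differs from 1.
  Both xa and a^-1 y are required to exist.\<close>

inductive estep :: "'a list \<Rightarrow> 'a list \<Rightarrow> bool" where
  estepI: "M x a x' \<Longrightarrow> M (\<i> a) y y' \<Longrightarrow> estep (xs @ x # y # ys) (xs @ x' # y' # ys)"

lemma estep_length: "estep u v \<Longrightarrow> length u = length v"
  by (auto elim!: estep.cases)

text \<open>The move with \<open>a\<close> is undone by the move with a^-1.\<close>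

lemma estep_sym: "estep u v \<Longrightarrow> estep v u"
proof (induction rule: estep.induct)
  case (estepI x a x' y y' xs ys)
  then show ?case using estep.estepI[OF M_cancel_right M_cancel_left] by blast
qed

lemma estep_rtranclp_sym: "estep\<^sup>*\<^sup>* u v \<Longrightarrow> estep\<^sup>*\<^sup>* v u"
  by (metis estep_sym sympD sympI symp_rtranclp)

lemma estep_rtranclp_length: "estep\<^sup>*\<^sup>* u v \<Longrightarrow> length u = length v"
  by (induction rule: rtranclp_induct) (auto dest: estep_length)

lemma estep_Cons: "estep u v \<Longrightarrow> estep (x # u) (x # v)"
  by (metis append_Cons estep.simps)

lemma estep_rtranclp_Cons: "estep\<^sup>*\<^sup>* u v \<Longrightarrow> estep\<^sup>*\<^sup>* (x # u) (x # v)"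
  by (induction rule: rtranclp_induct) (auto intro: estep_Cons rtranclp.rtrancl_into_rtrancl)

text \<open>Disjoint reductions commute. Overlapping ones need not have a common reduct, but their
  results differ by one move, which is why confluence holds only modulo moves.\<close>

lemma red_step_local_confluence:
  assumes "red_step P u v" "red_step P u v'"
  shows "estep\<^sup>*\<^sup>* v v' \<or> (\<exists>t. red_step P v t \<and> red_step P v' t)"
proof -
  obtain xs a b c ys where 1: "M a b c" "u = xs @ a # b # ys" "v = xs @ c # ys"
    using assms(1) by (auto simp: red_step_iff)
  obtain xs' a' b' c' ys' where 2: "M a' b' c'" "u = xs' @ a' # b' # ys'" "v' = xs' @ c' # ys'"
    using assms(2) by (auto simp: red_step_iff)
  \<comment> \<open>The move with \<open>b\<close> turns a, bd into ab, d, because b^-1 (bd) =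
    d.\<close>
  have overlap: "estep (xs @ a # s # zs) (xs @ r # d # zs)" if "M a b r" "M b d s"
    for a b d r s :: 'a and xs zs
    using estepI[OF that(1) M_cancel_left[OF that(2)]] .
  from 1(2) 2(2) have "xs @ a # b # ys = xs' @ a' # b' # ys'" by simp
  then show ?thesis
  proof (cases rule: adjacent_pairs_cases)
    case same
    then show ?thesis using 1 2 M_unique by auto
  next
    case overlap_right
    then show ?thesis using overlap[of a b c b' c' xs ys'] 1 2 estep_sym by auto
  next
    case overlap_left
    then show ?thesis using overlap[of a' b' c' b c xs' ys] 1 2 by auto
  next
    case (right zs)
    then have "red_step P v (xs @ c # zs @ c' # ys')" "red_step P v' (xs @ c # zs @ c' # ys')"
      using red_stepI[OF 2(1), of "xs @ c # zs" ys'] red_stepI[OF 1(1), of xs "zs @ c' # ys'"] 1 2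
      by auto
    then show ?thesis by blast
  next
    case (left zs)
    then have "red_step P v (xs' @ c' # zs @ c # ys)" "red_step P v' (xs' @ c' # zs @ c # ys)"
      using red_stepI[OF 1(1), of "xs' @ c' # zs" ys] red_stepI[OF 2(1), of xs' "zs @ c # ys"] 1 2
      by auto
    then show ?thesis by blast
  qed
qed

text \<open>The reduct \<open>t\<close> need not be the given \<open>v\<close>. If the given
  reduction overlaps the move, axiom (viii) offers two cases: either the reduction can also be made
  after the move, or the moved pair itself multiplies, and then that pair is reduced
  instead.\<close>

lemma estep_local_coherence:
  assumes "estep u u'" "red_step P u v"
  shows "\<exists>t t'. red_step P u t \<and> red_step P u' t' \<and> estep\<^sup>*\<^sup>* t t'"
proof -
  obtain xs x a x' y y' ys where 1: "M x a x'" "M (\<i> a) y y'"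
    "u = xs @ x # y # ys" "u' = xs @ x' # y' # ys"
    using assms(1) by (auto elim: estep.cases)
  obtain xs' p q r ys' where 2: "M p q r" "u = xs' @ p # q # ys'" "v = xs' @ r # ys'"
    using assms(2) by (auto simp: red_step_iff)
  note 3 = M_cancel_right[OF 1(1)] M_cancel_left[OF 1(2)]
  have inv_a: "\<i> (\<i> a) = a" using 1 M_closed inv_inv by blast
  \<comment> \<open>Since (xa)(a^-1 y) = xy, reducing the moved pair leads from \<open>u\<close> and
    \<open>u'\<close> to the same word.\<close>
  have xy: ?thesis if "M x y z" for z
  proof -
    have "M x' y' z" using that M_assoc[OF 3(1) 1(2)] by blast
    then show ?thesis using that 1 red_stepI by blast
  qed
  from 1(3) 2(2) have "xs @ x # y # ys = xs' @ p # q # ys'" by simp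
  then show ?thesis
  proof (cases rule: adjacent_pairs_cases)
    case same
    then show ?thesis using xy 2 by blast
  next
    case overlap_right
    then have yq: "M y q r" using 2 by simp
    \<comment> \<open>Axiom (viii) for x', a^-1, y, q, whose inner product is y'.\<close>
    from M_four[OF 3(1) 1(2) yq] consider (1) s where "M x' y' s" | (2) s where "M y' q s" by blast
    then show ?thesis
    proof cases
      case (1 s)
      then show ?thesis using xy M_assoc[OF 3(1) \<open>M (\<i> a) y y'\<close>] by blast
    next
      case (2 s)
      then have "M (\<i> a) r s" using M_assoc[OF 1(2) yq] by blast
      then have "estep (xs @ x # r # ys') (xs @ x' # s # ys')" using estepI 1 by blast
      moreover have "red_step P u (xs @ x # r # ys')"
        using red_stepI[OF yq, of "xs @ [x]" ys'] overlap_right 1 by simp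
      moreover have "red_step P u' (xs @ x' # s # ys')"
        using red_stepI[OF 2, of "xs @ [x']" ys'] overlap_right 1 by simp
      ultimately show ?thesis by blast
    qed
  next
    case overlap_left
    then have px: "M p x r" using 2 by simp
    from 3(2) inv_a have ay: "M a y' y" by simp
    from M_four[OF px 1(1) ay] consider (1) s where "M p x' s" | (2) s where "M x' y' s" by blast
    then show ?thesis
    proof cases
      case (2 s)
      then show ?thesis using xy M_assoc[OF 3(1) 1(2)] by blast
    next
      case (1 s)
      then have "M r a s" using M_assoc[OF px \<open>M x a x'\<close>] by blast
      then have "estep (xs' @ r # y # ys) (xs' @ s # y' # ys)" using estepI \<open>M (\<i> a) y y'\<close> by blast
      moreover have "red_step P u (xs' @ r # y # ys)"
        using red_stepI[OF px, of xs' "y # ys"] overlap_left \<open>u = xs @ _\<close> by simp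
      moreover have "red_step P u' (xs' @ s # y' # ys)"
        using red_stepI[OF 1, of xs' "y' # ys"] overlap_left \<open>u' = xs @ _\<close> by simp
      ultimately show ?thesis by blast
    qed
  next
    case (right zs)
    have "red_step P u (xs @ x # y # zs @ r # ys')" "red_step P u' (xs @ x' # y' # zs @ r # ys')"
      using red_stepI[OF 2(1), of "xs @ x # y # zs" ys']
        red_stepI[OF 2(1), of "xs @ x' # y' # zs" ys'] 1 right by auto
    moreover have "estep (xs @ x # y # zs @ r # ys') (xs @ x' # y' # zs @ r # ys')"
      using estepI 1 by blast
    ultimately show ?thesis by blast
  next
    case (left zs)
    have "red_step P u (xs' @ r # zs @ x # y # ys)" "red_step P u' (xs' @ r # zs @ x' # y' # ys)"
      using red_stepI[OF 2(1), of xs' "zs @ x # y # ys"]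
        red_stepI[OF 2(1), of xs' "zs @ x' # y' # ys"] 1 left by auto
    moreover have "estep (xs' @ r # zs @ x # y # ys) (xs' @ r # zs @ x' # y' # ys)"
      using estepI[OF 1(1,2), of "xs' @ r # zs" ys] by simp
    ultimately show ?thesis by blast
  qed
qed

lemma estep_reduced: "estep u v \<Longrightarrow> reduced P u \<Longrightarrow> reduced P v"
  using estep_local_coherence[OF estep_sym] not_reduced_iff by blast

lemma estep_rtranclp_reduced: "estep\<^sup>*\<^sup>* u v \<Longrightarrow> reduced P u \<Longrightarrow> reduced P v"
  by (induction rule: rtranclp_induct) (auto dest: estep_reduced)

text \<open>Newman's lemma modulo an equivalence, by induction on length: moves preserve length and
  reductions lower it. \<open>same\<close> compares two normal forms of one word by local
  confluence, \<open>single\<close> those of two words one move apart by local coherence, and an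
  inner induction treats chains of moves.\<close>

lemma normal_form_unique_mod_estep:
  "estep\<^sup>*\<^sup>* u u' \<Longrightarrow> normal_form u w \<Longrightarrow> normal_form u' w' \<Longrightarrow> estep\<^sup>*\<^sup>* w w'"
proof (induction "length u" arbitrary: u u' w w' rule: less_induct)
  case less
  note trans = rtranclp_trans[of estep]
  have same: "estep\<^sup>*\<^sup>* z z'" if nf: "length t = length u" "normal_form t z" "normal_form t z'" for t z z'
    using nf(2)
  proof (cases rule: normal_form_cases)
    case 1
    then show ?thesis using nf(3) not_reduced_iff by (metis normal_form_cases rtranclp.rtrancl_refl)
  next
    case (2 v)
    then obtain v' where v': "red_step P t v'" "normal_form v' z'"
      using nf(3) not_reduced_iff by (metis normal_form_cases)
    have len: "length v < length u" "length v' < length u"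
      using 2 v' nf red_step_length by fastforce+
    from red_step_local_confluence[OF 2(1) v'(1)] show ?thesis
    proof
      assume "estep\<^sup>*\<^sup>* v v'"
      then show ?thesis using less(1)[OF len(1)] 2 v' by blast
    next
      assume "\<exists>r. red_step P v r \<and> red_step P v' r"
      then obtain r s where "red_step P v r" "red_step P v' r" "normal_form r s"
        using normal_form_exists by blast
      then have "normal_form v s" "normal_form v' s" by (auto intro: normal_form_step)
      then have "estep\<^sup>*\<^sup>* z s" "estep\<^sup>*\<^sup>* s z'"
        using less(1)[OF len(1)] less(1)[OF len(2)] 2 v' by blast+
      then show ?thesis by (rule trans)
    qed
  qed
  have single: "estep\<^sup>*\<^sup>* z z'" if nf: "estep t t'" "length t = length u" "normal_form t z" "normal_form t' z'"
    for t t' z z'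
  proof (cases "reduced P t")
    case True
    then have "z = t" "z' = t'"
      using nf estep_reduced not_reduced_iff by (metis normal_form_cases)+
    then show ?thesis using nf(1) by blast
  next
    case False
    then obtain s s' where s: "red_step P t s" "red_step P t' s'" "estep\<^sup>*\<^sup>* s s'"
      using estep_local_coherence[OF nf(1)] not_reduced_iff by blast
    obtain q q' where q: "normal_form s q" "normal_form s' q'" using normal_form_exists by blast
    have "estep\<^sup>*\<^sup>* q q'" using less(1)[OF _ s(3) q] s(1) nf(2) red_step_length by force
    \<comment> \<open>Coherence chose the first reduction of \<open>t\<close>, which need not be the
      one leading to \<open>z\<close>; \<open>same\<close> bridges the difference.\<close>
    moreover have "estep\<^sup>*\<^sup>* z q" using same[OF nf(2,3)] normal_form_step[OF s(1) q(1)] .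
    moreover have "estep\<^sup>*\<^sup>* q' z'"
      using same[OF _ normal_form_step[OF s(2) q(2)] nf(4)] nf(1,2) estep_length by simp
    ultimately show ?thesis using trans by blast
  qed
  from less(2) show ?case using less(4)
  proof (induction arbitrary: w' rule: rtranclp_induct)
    case base
    then show ?case using same less(3) by blast
  next
    case (step t t')
    obtain q where q: "normal_form t q" using normal_form_exists by blast
    have "length t = length u" using step(1) estep_rtranclp_length by simp
    then show ?case using trans[OF step.IH[OF q]] single[OF step(2) _ q step(4)] by blast
  qed
qed

section \<open>Interleaving\<close>

text \<open>An interleaving whose leading letter \<open>a\<^sub>0\<close> is an arbitrary \<open>p\<close>: this is what remains of
  an interleaving with \<open>a\<^sub>0 = 1\<close> after its first letters have been consumed.\<close>

inductive ilv :: "'a \<Rightarrow> 'a list \<Rightarrow> 'a list \<Rightarrow> bool" where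
  ilv_Nil: "ilv \<e> [] []"
| ilv_Cons: "M (\<i> p) c y \<Longrightarrow> M y a d \<Longrightarrow> ilv a cs ds \<Longrightarrow> ilv p (c # cs) (d # ds)"

inductive_cases ilv_NilE: "ilv p [] ds"
inductive_cases ilv_ConsE: "ilv p (c # cs) ds"
inductive_cases ilv_Cons2E: "ilv p cs (d # ds)"

text \<open>\<open>A\<close> lists the entries a_0, ..., a_k, so this links the recursive form to
  the indexed definition of interleaving.\<close>

lemma ilv_iff:
  "ilv p c d \<longleftrightarrow> (\<exists>A. A 0 = p \<and> A (length c) = \<e> \<and> length d = length c \<and>
     (\<forall>j<length c. \<exists>y. M (\<i> (A j)) (c ! j) y \<and> M y (A (Suc j)) (d ! j)))"
proof (induction c arbitrary: p d)
  case Nil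
  show ?case by (auto elim: ilv_NilE intro: ilv_Nil)
next
  case (Cons c cs)
  show ?case
  proof
    assume "ilv p (c # cs) d"
    then obtain y a d0 ds where *: "d = d0 # ds" "M (\<i> p) c y" "M y a d0" "ilv a cs ds"
      by (rule ilv_ConsE)
    then obtain A where A: "A 0 = a" "A (length cs) = \<e>" "length ds = length cs"
      "\<forall>j<length cs. \<exists>y. M (\<i> (A j)) (cs ! j) y \<and> M y (A (Suc j)) (ds ! j)"
      using Cons.IH by blast
    show "\<exists>A. A 0 = p \<and> A (length (c # cs)) = \<e> \<and> length d = length (c # cs) \<and>
      (\<forall>j<length (c # cs). \<exists>y. M (\<i> (A j)) ((c # cs) ! j) y \<and> M y (A (Suc j)) (d ! j))"
      using A * by (intro exI[of _ "case_nat p A"]) (auto simp: less_Suc_eq_0_disj)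
  next
    assume "\<exists>A. A 0 = p \<and> A (length (c # cs)) = \<e> \<and> length d = length (c # cs) \<and>
      (\<forall>j<length (c # cs). \<exists>y. M (\<i> (A j)) ((c # cs) ! j) y \<and> M y (A (Suc j)) (d ! j))"
    then obtain A where A: "A 0 = p" "A (Suc (length cs)) = \<e>" "length d = Suc (length cs)"
      "\<forall>j<Suc (length cs). \<exists>y. M (\<i> (A j)) ((c # cs) ! j) y \<and> M y (A (Suc j)) (d ! j)"
      by auto
    then obtain d0 ds where d: "d = d0 # ds" by (cases d) auto
    have "\<exists>y. M (\<i> (A (Suc j))) (cs ! j) y \<and> M y (A (Suc (Suc j))) (ds ! j)"
      if "j < length cs" for j
      using A(4)[rule_format, of "Suc j"] that d by simp
    then have "ilv (A (Suc 0)) cs ds"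
      unfolding Cons.IH using A d by (intro exI[of _ "A \<circ> Suc"]) simp
    moreover obtain y where "M (\<i> p) c y" "M y (A (Suc 0)) d0"
      using A(1) A(4)[rule_format, of 0] d by auto
    ultimately show "ilv p (c # cs) d" unfolding d by (blast intro: ilv_Cons)
  qed
qed

lemma D_pmul: "D x y \<Longrightarrow> M x y (pmul P x y)"
  using pmul_eq by (auto simp: D_iff)

lemma approx_iff_ilv: "approx P c d \<longleftrightarrow> c \<noteq> [] \<and> ilv \<e> c d"
proof
  assume "approx P c d"
  then obtain a where a: "interleave_ok P c a" "d = interleave P c a" by (auto simp: approx_def)
  let ?A = "ilv_a P (length c) a"
  have "\<exists>y. M (\<i> (?A j)) (c ! j) y \<and> M y (?A (Suc j)) (d ! j)" if "j < length c" for j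
    using a that D_pmul by (auto simp: interleave_ok_def interleave_def)
  then have "ilv \<e> c d" unfolding ilv_iff
    using a by (intro exI[of _ ?A]) (auto simp: interleave_def ilv_a_def)
  moreover have "c \<noteq> []" using a by (auto simp: interleave_ok_def)
  ultimately show "c \<noteq> [] \<and> ilv \<e> c d" by simp
next
  assume "c \<noteq> [] \<and> ilv \<e> c d"
  then obtain A where c: "c \<noteq> []" and A: "A 0 = \<e>" "A (length c) = \<e>" "length d = length c"
      "\<And>j. j < length c \<Longrightarrow> \<exists>y. M (\<i> (A j)) (c ! j) y \<and> M y (A (Suc j)) (d ! j)"
    by (auto simp: ilv_iff)
  \<comment> \<open>Position 0 of the list holds a_1, hence the shift by \<open>Suc\<close>; the end
    values a_0 = a_k = 1 are supplied by \<open>ilv_a\<close>.\<close>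
  define a where "a = map (\<lambda>j. A (Suc j)) [0..<length c - 1]"
  have ilv_a: "ilv_a P (length c) a j = A j" if "j \<le> length c" for j
    using that A c by (auto simp: ilv_a_def a_def)
  have "A (Suc j) \<in> C" if "j < length c" for j using A(4)[OF that] M_closed by blast
  then have "pword P a" by (auto simp: pword_def a_def)
  moreover have "D (\<i> (A j)) (c ! j) \<and> D (pmul P (\<i> (A j)) (c ! j)) (A (Suc j))
      \<and> pmul P (pmul P (\<i> (A j)) (c ! j)) (A (Suc j)) = d ! j" if "j < length c" for j
    using A(4)[OF that] pmul_eq by (auto simp: D_iff)
  ultimately have "interleave_ok P c a" "d = interleave P c a"
    using A c ilv_a by (auto simp: interleave_ok_def interleave_def a_def[THEN arg_cong[of _ _ length]]
        intro!: nth_equalityI)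
  then show "approx P c d" by (auto simp: approx_def)
qed

text \<open>The moves are made from left to right. Earlier moves have already turned the first
  letter into y = p^-1 c; the move with the next entry \<open>a\<close> completes it to ya and
  passes a^-1 on to the following letter.\<close>

lemma ilv_imp_estep_rtranclp:
  "ilv p cs ds \<Longrightarrow> cs = c # cs' \<Longrightarrow> M (\<i> p) c y \<Longrightarrow> estep\<^sup>*\<^sup>* (y # cs') ds"
proof (induction arbitrary: c cs' y rule: ilv.induct)
  case ilv_Nil
  then show ?case by simp
next
  case (ilv_Cons p c0 y0 a d cs ds)
  then have [simp]: "cs' = cs" "y0 = y" using M_unique by auto
  show ?case
  proof (cases cs)
    case Nil
    \<comment> \<open>At the last letter the next entry is forced to be 1, so no move is left to
      make.\<close>
    then have "a = \<e>" "ds = []" using ilv_Cons(3) by (auto elim: ilv_NilE)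
    then have "d = y" using ilv_Cons(2) M_one(1) M_unique M_closed by (metis \<open>y0 = y\<close>)
    then show ?thesis using Nil \<open>ds = []\<close> by simp
  next
    case (Cons c1 cs1)
    then obtain y1 where y1: "M (\<i> a) c1 y1" using ilv_Cons(3) by (auto elim: ilv_ConsE)
    have "estep (y # cs') (d # y1 # cs1)"
      using estepI[OF _ y1, of y d "[]" cs1] ilv_Cons(2) Cons by simp
    moreover have "estep\<^sup>*\<^sup>* (d # y1 # cs1) (d # ds)"
      using ilv_Cons.IH[OF Cons y1] by (rule estep_rtranclp_Cons)
    ultimately show ?thesis by (rule converse_rtranclp_into_rtranclp)
  qed
qed

text \<open>The entry \<open>a\<close> between the two letters becomes ab and all other entries
  stay. Axiom (viii) provides the products this needs; since xy is undefined, so is x'y', which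
  rules out its other alternative.\<close>

lemma ilv_estep:
  assumes "ilv p cs (xs @ x # y # ys)" "M x b x'" "M (\<i> b) y y'" "\<not> D x y"
  shows "ilv p cs (xs @ x' # y' # ys)"
  using assms(1)
proof (induction xs arbitrary: p cs)
  case (Cons d xs)
  then show ?case by (auto elim!: ilv_Cons2E intro: ilv_Cons)
next
  case Nil
  then obtain c1 y1 a cs1 where 1: "cs = c1 # cs1" "M (\<i> p) c1 y1" "M y1 a x" "ilv a cs1 (y # ys)"
    by (auto elim: ilv_Cons2E)
  then obtain c2 z a2 cs2 where 2: "cs1 = c2 # cs2" "M (\<i> a) c2 z" "M z a2 y" "ilv a2 cs2 ys"
    by (auto elim: ilv_Cons2E)
  have b: "M b y' y" using M_cancel_left[OF assms(3)] inv_inv M_closed(2)[OF assms(2)] by simp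
  have nxy: "\<not> M x y r" for r using assms(4) by (auto simp: D_iff)
  \<comment> \<open>Axiom (viii) for y1^-1, x, b, y'. Since y1^-1 x = a, this makes ab
    defined.\<close>
  from M_four[OF M_cancel_left[OF 1(3)] assms(2) b] obtain r where "M (\<i> y1) x' r"
    using M_assoc[OF assms(2) b] nxy by blast
  then obtain s where s: "M a b s" using M_assoc[OF M_cancel_left[OF 1(3)] assms(2)] by blast
  have y1s: "M y1 s x'" using M_assoc[OF 1(3) s] assms(2) by blast
  note zy = M_cancel_right[OF 2(3)]
  \<comment> \<open>Axiom (viii) for x', b^-1, y, a2^-1. The product z' obtained here is the value
    of (ab)^-1 c2.\<close>
  from M_four[OF M_cancel_right[OF assms(2)] assms(3) zy] obtain z' where z': "M y' (\<i> a2) z'"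
    using M_assoc[OF M_cancel_right[OF assms(2)] assms(3)] nxy by blast
  then have bz: "M (\<i> b) z z'" using M_assoc[OF assms(3) zy] by blast
  then have "M (\<i> s) c2 z'" using M_assoc[OF M_inv_rev[OF s] 2(2)] by blast
  moreover have "M z' a2 y'" using M_assoc[OF bz 2(3)] assms(3) by blast
  ultimately show ?case using 1 2 y1s by (auto intro: ilv_Cons)
qed

lemma ilv_refl: "pword P c \<Longrightarrow> ilv \<e> c c"
  by (induction c) (auto simp: pword_def inv_one intro!: ilv_Nil ilv_Cons M_one)

text \<open>On reduced words interleaving is the equivalence generated by moves: an interleaving
  splits into moves, and conversely each further move is absorbed, as words reached by moves stay
  reduced.\<close>

lemma wcls_eq_estep_class:
  assumes "pword P c" "c \<noteq> []" "reduced P c"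
  shows "wcls P c = {d. estep\<^sup>*\<^sup>* c d}"
proof -
  have "estep\<^sup>*\<^sup>* c d" if "ilv \<e> c d" for d
    using that ilv_imp_estep_rtranclp[OF that] assms M_one(2) inv_one
    by (cases c) (auto simp: pword_def)
  moreover have "ilv \<e> c d" if "estep\<^sup>*\<^sup>* c d" for d
    using that
  proof (induction rule: rtranclp_induct)
    case base
    show ?case using assms ilv_refl by simp
  next
    case (step d e)
    have red: "reduced P d" using step(1) assms(3) estep_rtranclp_reduced by blast
    from step(2) show ?case
    proof cases
      case (estepI x a x' y y' xs ys)
      then have "\<not> D x y" using red not_reduced_iff red_stepI unfolding D_iff by metis
      then show ?thesis using ilv_estep step.IH estepI by blast
    qed
  qed
  ultimately show ?thesis using assms(2) by (auto simp: wcls_def approx_iff_ilv)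
qed

section \<open>The universal group as a quotient of the words\<close>

abbreviation eqv :: "'a list \<Rightarrow> 'a list \<Rightarrow> bool" (infix "\<simeq>" 50) where
  "u \<simeq> v \<equiv> equivclp (red_step P) u v"

lemma eqv_refl: "u \<simeq> u"
  by simp

lemma eqv_trans [trans]: "u \<simeq> v \<Longrightarrow> v \<simeq> w \<Longrightarrow> u \<simeq> w"
  by (rule equivclp_trans)

lemma eqv_red_step: "red_step P u v \<Longrightarrow> u \<simeq> v"
  by (rule r_into_equivclp)

lemma eqv_red_rtranclp: "(red_step P)\<^sup>*\<^sup>* u v \<Longrightarrow> u \<simeq> v"
  by (rule predicate2D[OF rtranlcp_le_equivclp])

lemma eqv_context: "u \<simeq> v \<Longrightarrow> xs @ u @ ys \<simeq> xs @ v @ ys"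
proof (induction rule: equivclp_induct)
  case base
  show ?case by simp
next
  case (step y z)
  then show ?case using red_step_context by (blast intro: equivclp_into_equivclp)
qed

lemma eqv_append: "u \<simeq> u' \<Longrightarrow> v \<simeq> v' \<Longrightarrow> u @ v \<simeq> u' @ v'"
  using eqv_context[of u u' "[]" v] eqv_context[of v v' u' "[]"] eqv_trans by simp

text \<open>Both words are reducts of the word with x, a, a^-1, y in the place of the pair: multiply
  either the inner two letters or the outer pairs.\<close>

lemma estep_imp_eqv:
  assumes "estep u v"
  shows "u \<simeq> v"
  using assms
proof cases
  case (estepI x a x' y y' xs ys)
  have a: "a \<in> C" and y: "y \<in> C" using estepI M_closed by blast+
  let ?z = "xs @ x # a # \<i> a # y # ys"
  have "?z \<simeq> xs @ x # \<e> # y # ys"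
    using red_stepI[OF M_inverse(1)[OF a], of "xs @ [x]" "y # ys"] eqv_red_step by simp
  also have "\<dots> \<simeq> u"
    using red_stepI[OF M_one(2)[OF y], of "xs @ [x]" ys] eqv_red_step estepI by simp
  finally have "?z \<simeq> u" .
  moreover have "?z \<simeq> xs @ x' # \<i> a # y # ys"
    using red_stepI estepI eqv_red_step by blast
  moreover have "xs @ x' # \<i> a # y # ys \<simeq> v"
    using red_stepI[OF estepI(4), of "xs @ [x']" ys] eqv_red_step estepI by simp
  ultimately show ?thesis using eqv_trans equivclp_sym by metis
qed

lemma estep_rtranclp_imp_eqv: "estep\<^sup>*\<^sup>* u v \<Longrightarrow> u \<simeq> v"
  by (induction rule: rtranclp_induct) (auto intro: eqv_trans estep_imp_eqv)

text \<open>Along a zigzag of reductions, a normal form of the shorter word is also one of the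
  longer word.\<close>

lemma eqv_normal_forms:
  "u \<simeq> v \<Longrightarrow> normal_form u w \<Longrightarrow> normal_form v w' \<Longrightarrow> estep\<^sup>*\<^sup>* w w'"
proof (induction arbitrary: w' rule: equivclp_induct)
  case base
  then show ?case using normal_form_unique_mod_estep by blast
next
  case (step y z)
  obtain q where q: "normal_form y q" using normal_form_exists by blast
  from step(2) show ?case
  proof
    assume "red_step P y z"
    then show ?thesis using step normal_form_step by blast
  next
    assume "red_step P z y"
    then have "normal_form z q" using q normal_form_step by blast
    then have "estep\<^sup>*\<^sup>* q w'" using step normal_form_unique_mod_estep by blast
    then show ?thesis using step.IH[OF step(4) q] by (rule rtranclp_trans[rotated])
  qed
qed

section \<open>Classes of arbitrary nonempty words\<close>

definition words :: "'a list set" where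
  "words = {u. u \<noteq> [] \<and> set u \<subseteq> C}"

text \<open>The choice is harmless on \<open>words\<close>: two normal forms differ by moves and so
  have the same class.\<close>

definition cls :: "'a list \<Rightarrow> 'a list set" where
  "cls u = wcls P (SOME w. normal_form u w)"

definition winv :: "'a list \<Rightarrow> 'a list" where
  "winv u = rev (map \<i> u)"

lemma words_append: "u \<in> words \<Longrightarrow> v \<in> words \<Longrightarrow> u @ v \<in> words"
  by (auto simp: words_def)

lemma words_winv: "u \<in> words \<Longrightarrow> winv u \<in> words"
  using inv_closed by (auto simp: words_def winv_def)

lemma words_single: "x \<in> C \<Longrightarrow> [x] \<in> words"
  by (auto simp: words_def)

lemma words_red_rtranclp: "(red_step P)\<^sup>*\<^sup>* u v \<Longrightarrow> u \<in> words \<Longrightarrow> v \<in> words"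
  by (induction rule: rtranclp_induct) (auto simp: words_def red_step_iff dest: M_closed)

lemma words_estep: "estep u v \<Longrightarrow> u \<in> words \<Longrightarrow> v \<in> words"
  by (auto simp: words_def elim!: estep.cases dest: M_closed)

lemma words_estep_rtranclp: "estep\<^sup>*\<^sup>* u v \<Longrightarrow> u \<in> words \<Longrightarrow> v \<in> words"
  by (induction rule: rtranclp_induct) (auto intro: words_estep)

lemma wcls_words: "w \<in> words \<Longrightarrow> reduced P w \<Longrightarrow> wcls P w = {d. estep\<^sup>*\<^sup>* w d}"
  by (rule wcls_eq_estep_class) (auto simp: words_def pword_def)

lemma normal_form_some: "normal_form u (SOME w. normal_form u w)"
  using normal_form_exists by (rule someI_ex)

lemma cls_eq_wcls:
  assumes "u \<in> words" "w \<in> words" "reduced P w" "u \<simeq> w"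
  shows "cls u = wcls P w"
proof -
  let ?n = "SOME w. normal_form u w"
  have n: "normal_form u ?n" by (rule normal_form_some)
  then have "?n \<in> words" using assms(1) words_red_rtranclp by (auto simp: normal_form_def)
  then have 1: "cls u = {d. estep\<^sup>*\<^sup>* ?n d}"
    using n by (auto simp: cls_def wcls_words normal_form_def)
  have "normal_form w w" using assms(3) by (simp add: normal_form_def)
  then have 2: "estep\<^sup>*\<^sup>* ?n w" using eqv_normal_forms[OF assms(4) n] by blast
  show ?thesis unfolding 1 wcls_words[OF assms(2,3)]
    using 2 estep_rtranclp_sym[OF 2] rtranclp_trans[of estep] by blast
qed

lemma cls_normal_form:
  assumes "u \<in> words" "normal_form u w"
  shows "cls u = wcls P w" "w \<in> words" "reduced P w" "u \<simeq> w"
proof -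
  show w: "w \<in> words" "reduced P w" "u \<simeq> w"
    using assms words_red_rtranclp eqv_red_rtranclp by (auto simp: normal_form_def)
  show "cls u = wcls P w" using assms(1) w by (rule cls_eq_wcls)
qed

lemma cls_eq_iff:
  assumes "u \<in> words" "v \<in> words"
  shows "cls u = cls v \<longleftrightarrow> u \<simeq> v"
proof -
  obtain w w' where w: "normal_form u w" "normal_form v w'" using normal_form_exists by blast
  note cu = cls_normal_form[OF assms(1) w(1)] and cv = cls_normal_form[OF assms(2) w(2)]
  show ?thesis
  proof
    assume "cls u = cls v"
    then have "estep\<^sup>*\<^sup>* w w'" using cu cv wcls_words by auto
    then show "u \<simeq> v" using cu(4) cv(4) estep_rtranclp_imp_eqv eqv_trans equivclp_sym by metis
  next
    assume "u \<simeq> v"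
    then have "u \<simeq> w'" using cv(4) by (rule eqv_trans)
    then show "cls u = cls v" using cls_eq_wcls[OF assms(1) cv(2,3)] cv(1) by simp
  qed
qed

lemma cls_reduced: "w \<in> words \<Longrightarrow> reduced P w \<Longrightarrow> cls w = wcls P w"
  by (rule cls_eq_wcls) auto

lemma reduced_single: "reduced P [x]"
  by (auto simp: reduced_def)

lemma wcls_single: "x \<in> C \<Longrightarrow> wcls P [x] = cls [x]"
  using cls_reduced words_single reduced_single by simp

text \<open>A one-letter word admits no move, so its class is a singleton and a normal form must be
  that word literally.\<close>

lemma cls_eq_single_iff:
  assumes "u \<in> words" "x \<in> C" "normal_form u w"
  shows "cls u = cls [x] \<longleftrightarrow> w = [x]"
proof
  assume "cls u = cls [x]"
  then have "u \<simeq> [x]" using assms cls_eq_iff words_single by blast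
  moreover have "normal_form [x] [x]" by (simp add: normal_form_def reduced_single)
  ultimately have "estep\<^sup>*\<^sup>* [x] w" using assms(3) eqv_normal_forms equivclp_sym by metis
  then show "w = [x]"
    by (cases rule: converse_rtranclpE) (auto elim: estep.cases)
next
  assume "w = [x]"
  then show "cls u = cls [x]" using assms cls_normal_form wcls_single by metis
qed

section \<open>Product and inverse in the universal group\<close>

lemma Ucarrier_eq: "Ucarrier P = cls ` words"
proof
  show "Ucarrier P \<subseteq> cls ` words"
  proof
    fix X assume "X \<in> Ucarrier P"
    then obtain c where "c \<in> words" "reduced P c" "X = wcls P c"
      by (auto simp: Ucarrier_def words_def pword_def)
    then show "X \<in> cls ` words" using cls_reduced by blast
  qed
  show "cls ` words \<subseteq> Ucarrier P"
  proof
    fix X assume "X \<in> cls ` words"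
    then obtain u w where "u \<in> words" "X = cls u" "normal_form u w" using normal_form_exists by blast
    then show "X \<in> Ucarrier P" using cls_normal_form[of u w]
      by (auto simp: Ucarrier_def words_def pword_def)
  qed
qed

text \<open>The choice in \<open>Umul\<close> has only one possible value: representatives and
  reductions all stay within one class of \<simeq>.\<close>

lemma Umul_cls:
  assumes u: "u \<in> words" and v: "v \<in> words"
  shows "Umul P (cls u) (cls v) = cls (u @ v)"
proof -
  obtain nu nv where n: "normal_form u nu" "normal_form v nv" using normal_form_exists by blast
  note cu = cls_normal_form[OF u n(1)] and cv = cls_normal_form[OF v n(2)]
  have *: "wcls P w = cls (u @ v)"
    if u': "estep\<^sup>*\<^sup>* nu u'" and v': "estep\<^sup>*\<^sup>* nv v'" and w: "normal_form (u' @ v') w" for u' v' w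
  proof -
    have W: "u' @ v' \<in> words" using u' v' cu cv words_estep_rtranclp words_append by blast
    have "u \<simeq> u'" "v \<simeq> v'" using u' v' cu(4) cv(4) estep_rtranclp_imp_eqv eqv_trans by blast+
    then have "u @ v \<simeq> u' @ v'" by (rule eqv_append)
    then show ?thesis using cls_eq_iff[OF words_append[OF u v] W] cls_normal_form(1)[OF W w] by simp
  qed
  obtain w where w: "normal_form (nu @ nv) w" using normal_form_exists by blast
  have sets: "cls u = {d. estep\<^sup>*\<^sup>* nu d}" "cls v = {d. estep\<^sup>*\<^sup>* nv d}"
    using cu cv by (simp_all add: wcls_words)
  show ?thesis unfolding Umul_def
  proof (rule some_equality)
    have "reduced P w \<and> (red_step P)\<^sup>*\<^sup>* (nu @ nv) w \<and> cls (u @ v) = wcls P w"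
      using *[OF _ _ w] w by (simp add: normal_form_def)
    then show "\<exists>a\<in>cls u. \<exists>b\<in>cls v. \<exists>w. reduced P w \<and> (red_step P)\<^sup>*\<^sup>* (a @ b) w \<and> cls (u @ v) = wcls P w"
      unfolding sets by blast
  next
    fix Z
    assume "\<exists>a\<in>cls u. \<exists>b\<in>cls v. \<exists>w. reduced P w \<and> (red_step P)\<^sup>*\<^sup>* (a @ b) w \<and> Z = wcls P w"
    then obtain a b w where "estep\<^sup>*\<^sup>* nu a" "estep\<^sup>*\<^sup>* nv b" "normal_form (a @ b) w" "Z = wcls P w"
      unfolding sets normal_form_def by blast
    then show "Z = cls (u @ v)" using * by simp
  qed
qed

lemma eqv_one_left: "u \<in> words \<Longrightarrow> [\<e>] @ u \<simeq> u"
  using red_stepI[OF M_one(2), of _ "[]"] eqv_red_step by (cases u) (auto simp: words_def)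

lemma eqv_one_right: "u \<in> words \<Longrightarrow> u @ [\<e>] \<simeq> u"
  using red_stepI[OF M_one(1), of _ _ "[]"] eqv_red_step
  by (cases u rule: rev_cases) (auto simp: words_def)

lemma eqv_winv_right: "u \<in> words \<Longrightarrow> u @ winv u \<simeq> [\<e>]"
proof (induction u)
  case Nil
  then show ?case by (simp add: words_def)
next
  case (Cons x u)
  then have x: "x \<in> C" by (simp add: words_def)
  have base: "[x, \<i> x] \<simeq> [\<e>]"
    using red_stepI[OF M_inverse(1)[OF x], of "[]" "[]"] eqv_red_step by simp
  show ?case
  proof (cases "u = []")
    case True
    then show ?thesis using base by (simp add: winv_def)
  next
    case False
    then have u: "u \<in> words" using Cons.prems by (auto simp: words_def)
    have "(x # u) @ winv (x # u) = [x] @ (u @ winv u) @ [\<i> x]" by (simp add: winv_def)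
    also have "\<dots> \<simeq> [x] @ [\<e>] @ [\<i> x]" using Cons.IH[OF u] by (rule eqv_context)
    also have "\<dots> \<simeq> [x, \<i> x]"
      using eqv_red_step[OF red_stepI[OF M_one(1)[OF x], of "[]" "[\<i> x]"]] by simp
    also note base
    finally show ?thesis .
  qed
qed

lemma winv_winv: "u \<in> words \<Longrightarrow> winv (winv u) = u"
  using inv_inv by (auto simp: winv_def words_def rev_map intro!: map_idI)

lemma eqv_winv_left: "u \<in> words \<Longrightarrow> winv u @ u \<simeq> [\<e>]"
  using eqv_winv_right[of "winv u"] words_winv winv_winv by simp

lemma eqv_winv_unique:
  assumes u: "u \<in> words" and v: "v \<in> words" and uv: "u @ v \<simeq> [\<e>]"
  shows "v \<simeq> winv u"
proof -
  have "v \<simeq> [\<e>] @ v" using eqv_one_left[OF v] by (rule equivclp_sym)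
  also have "\<dots> \<simeq> (winv u @ u) @ v"
    using eqv_winv_left[OF u, THEN equivclp_sym] eqv_refl by (rule eqv_append)
  also have "\<dots> \<simeq> winv u @ [\<e>]" using eqv_append[OF eqv_refl uv] by simp
  also have "\<dots> \<simeq> winv u" using words_winv[OF u] by (rule eqv_one_right)
  finally show ?thesis .
qed

lemma Uone_eq: "Uone P = cls [\<e>]"
  using wcls_single one_closed by (simp add: Uone_def)

text \<open>Uniqueness of right inverses modulo \<simeq> settles the choice in
  \<open>Uinv\<close>.\<close>

lemma Uinv_cls:
  assumes u: "u \<in> words"
  shows "Uinv P (cls u) = cls (winv u)"
  unfolding Uinv_def Uone_eq Ucarrier_eq
proof (rule some_equality)
  note W = words_winv[OF u] words_single[OF one_closed]
  show "cls (winv u) \<in> cls ` words \<and> Umul P (cls u) (cls (winv u)) = cls [\<e>]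
      \<and> Umul P (cls (winv u)) (cls u) = cls [\<e>]"
    using u W words_append eqv_winv_left eqv_winv_right by (simp add: Umul_cls cls_eq_iff)
next
  fix Y
  assume "Y \<in> cls ` words \<and> Umul P (cls u) Y = cls [\<e>] \<and> Umul P Y (cls u) = cls [\<e>]"
  then obtain v where v: "v \<in> words" "Y = cls v" "cls (u @ v) = cls [\<e>]"
    using u by (auto simp: Umul_cls)
  then have "u @ v \<simeq> [\<e>]"
    using u words_append words_single[OF one_closed] by (simp add: cls_eq_iff)
  then show "Y = cls (winv u)"
    using eqv_winv_unique u v words_winv by (simp add: cls_eq_iff)
qed

text \<open>Turns the comparison of two words into the question whether one word reduces to
  1.\<close>

lemma eqv_iff_winv:
  assumes u: "u \<in> words" and v: "v \<in> words"
  shows "u \<simeq> v \<longleftrightarrow> u @ winv v \<simeq> [\<e>]"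
proof
  assume "u \<simeq> v"
  then have "u @ winv v \<simeq> v @ winv v" by (rule eqv_append) (rule eqv_refl)
  also have "\<dots> \<simeq> [\<e>]" using v by (rule eqv_winv_right)
  finally show "u @ winv v \<simeq> [\<e>]" .
next
  assume a: "u @ winv v \<simeq> [\<e>]"
  have "u \<simeq> u @ [\<e>]" using eqv_one_right[OF u] by (rule equivclp_sym)
  also have "\<dots> \<simeq> u @ (winv v @ v)"
    using eqv_refl eqv_winv_left[OF v, THEN equivclp_sym] by (rule eqv_append)
  also have "\<dots> \<simeq> [\<e>] @ v" using eqv_append[OF a eqv_refl] by simp
  also have "\<dots> \<simeq> v" using v by (rule eqv_one_left)
  finally show "u \<simeq> v" .
qed

end

section \<open>Transfer of existential sentences\<close>

text \<open>No reduction is performed, so only concatenation, constants and letterwise inverses have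
  to be matched by a letter map.\<close>

primrec tword :: "('a, 'c) spre \<Rightarrow> (nat \<Rightarrow> 'a list) \<Rightarrow> 'c gterm \<Rightarrow> 'a list" where
  "tword P \<omega> (GVar n) = \<omega> n"
| "tword P \<omega> (GConst c) = [sconst P c]"
| "tword P \<omega> (GMul s t) = tword P \<omega> s @ tword P \<omega> t"
| "tword P \<omega> (GInv t) = rev (map (pinv P) (tword P \<omega> t))"

text \<open>\<open>K\<close> will be the finite set of constants occurring in the formula at
  hand.\<close>

locale spre_struct = pregroup_struct P for P :: "('a, 'c) spre" +
  fixes K :: "'c set"
  assumes sconst_closed: "c \<in> K \<Longrightarrow> sconst P c \<in> C"
    and sdelta_closed: "sdelta P \<subseteq> C"
begin

lemma tword_words:
  "gt_consts t \<subseteq> K \<Longrightarrow> \<forall>i\<in>gt_vars t. \<omega> i \<in> words \<Longrightarrow> tword P \<omega> t \<in> words"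
proof (induction t)
  case (GInv t)
  then show ?case using words_winv by (simp add: winv_def)
qed (auto intro: words_append words_single sconst_closed)

lemma gt_eval_eq_cls:
  "gt_consts t \<subseteq> K \<Longrightarrow> \<forall>i\<in>gt_vars t. \<omega> i \<in> words \<and> \<rho> i = cls (\<omega> i)
    \<Longrightarrow> gt_eval (Ugroup P) \<rho> t = cls (tword P \<omega> t)"
proof (induction t)
  case (GVar i)
  then show ?case by simp
next
  case (GConst c)
  then show ?case using wcls_single sconst_closed by (simp add: Ugroup_def)
next
  case (GMul s t)
  then show ?case using tword_words[of s \<omega>] tword_words[of t \<omega>] by (simp add: Ugroup_def Umul_cls)
next
  case (GInv t)
  then show ?case using tword_words[of t \<omega>] by (simp add: Ugroup_def Uinv_cls winv_def)
qed

lemma gf_sat_GEq_iff: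
  assumes "gt_consts s \<subseteq> K" "gt_consts t \<subseteq> K"
    and "\<forall>i\<in>gt_vars s \<union> gt_vars t. \<omega> i \<in> words \<and> \<rho> i = cls (\<omega> i)"
    and w: "normal_form (tword P \<omega> (GMul s (GInv t))) w"
  shows "gf_sat (Ugroup P) \<rho> (GEq s t) \<longleftrightarrow> w = [\<e>]"
proof -
  have u: "tword P \<omega> s \<in> words" and v: "tword P \<omega> t \<in> words"
    using assms tword_words by auto
  have uv: "tword P \<omega> s @ winv (tword P \<omega> t) \<in> words" using u v words_append words_winv by blast
  have "gf_sat (Ugroup P) \<rho> (GEq s t) \<longleftrightarrow> cls (tword P \<omega> s) = cls (tword P \<omega> t)"
    using assms gt_eval_eq_cls[of s \<omega> \<rho>] gt_eval_eq_cls[of t \<omega> \<rho>] by simp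
  also have "\<dots> \<longleftrightarrow> cls (tword P \<omega> s @ winv (tword P \<omega> t)) = cls [\<e>]"
    using u v uv eqv_iff_winv words_single[OF one_closed] by (simp add: cls_eq_iff)
  also have "\<dots> \<longleftrightarrow> w = [\<e>]"
    using cls_eq_single_iff[OF uv one_closed] w by (simp add: winv_def)
  finally show ?thesis .
qed

lemma gf_sat_GDelta_iff:
  assumes "gt_consts t \<subseteq> K" "\<forall>i\<in>gt_vars t. \<omega> i \<in> words \<and> \<rho> i = cls (\<omega> i)"
    and w: "normal_form (tword P \<omega> t) w"
  shows "gf_sat (Ugroup P) \<rho> (GDelta t) \<longleftrightarrow> (\<exists>x\<in>sdelta P. w = [x])"
proof -
  have u: "tword P \<omega> t \<in> words" using assms tword_words by auto
  have "gf_sat (Ugroup P) \<rho> (GDelta t) \<longleftrightarrow> (\<exists>x\<in>sdelta P. cls (tword P \<omega> t) = wcls P [x])"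
    using assms gt_eval_eq_cls[of t \<omega> \<rho>] by (auto simp: Ugroup_def)
  also have "\<dots> \<longleftrightarrow> (\<exists>x\<in>sdelta P. w = [x])"
    using cls_eq_single_iff[OF u _ w] wcls_single sdelta_closed by (metis subsetD)
  finally show ?thesis .
qed

end

text \<open>\<open>f\<close> preserves and reflects the basic atomic relations among letters of
  \<open>F\<close>. As \<open>F\<close> need not be closed under anything, inverses, 1 and constants
  are compared only where they lie in \<open>F\<close>.\<close>

definition diagram_map ::
  "('a, 'c) spre \<Rightarrow> ('b, 'c) spre \<Rightarrow> 'c set \<Rightarrow> 'a set \<Rightarrow> ('a \<Rightarrow> 'b) \<Rightarrow> bool" where
  "diagram_map P1 P2 K F f \<longleftrightarrow>
     (\<forall>x\<in>F. f x \<in> pcarrier P2) \<and>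
     (\<forall>x\<in>F. \<forall>y\<in>F. f x = f y \<longleftrightarrow> x = y) \<and>
     (\<forall>x\<in>F. \<forall>y\<in>F. pD P2 (f x) (f y) \<longleftrightarrow> pD P1 x y) \<and>
     (\<forall>x\<in>F. \<forall>y\<in>F. \<forall>z\<in>F. pM P2 (f x) (f y) (f z) \<longleftrightarrow> pM P1 x y z) \<and>
     (\<forall>x\<in>F. \<forall>y\<in>F. pinv P2 (f x) = f y \<longleftrightarrow> pinv P1 x = y) \<and>
     (\<forall>x\<in>F. f x = pone P2 \<longleftrightarrow> x = pone P1) \<and>
     (\<forall>x\<in>F. \<forall>c\<in>K. f x = sconst P2 c \<longleftrightarrow> x = sconst P1 c) \<and>
     (\<forall>x\<in>F. f x \<in> sdelta P2 \<longleftrightarrow> x \<in> sdelta P1)"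

lemma diagram_map_subset: "diagram_map P1 P2 K F f \<Longrightarrow> F' \<subseteq> F \<Longrightarrow> diagram_map P1 P2 K F' f"
  unfolding diagram_map_def by (simp add: subset_iff)

section \<open>Realising finite atomic diagrams\<close>

lemma pre_ex_equiv_sym: "pre_ex_equiv S P1 P2 \<Longrightarrow> pre_ex_equiv S P2 P1"
  by (simp add: pre_ex_equiv_def)

lemma pre_ex_equiv_finite:
  assumes "pre_ex_equiv S P1 P2" "finite A" "\<And>\<phi>. \<phi> \<in> A \<Longrightarrow> pf_vars \<phi> \<subseteq> {..<n}"
    and "\<And>\<phi>. \<phi> \<in> A \<Longrightarrow> pf_consts \<phi> \<subseteq> Syms S" "\<rho> ` {..<n} \<subseteq> pcarrier P1"
  shows "\<exists>\<rho>'. \<rho>' ` {..<n} \<subseteq> pcarrier P2 \<and> (\<forall>\<phi>\<in>A. pf_sat P2 \<rho>' \<phi> \<longleftrightarrow> pf_sat P1 \<rho> \<phi>)"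
proof -
  have "\<exists>\<psi>. pf_vars \<psi> \<subseteq> {..<n} \<and> pf_consts \<psi> \<subseteq> Syms S \<and> pf_sat P1 \<rho> \<psi> \<and>
    (\<forall>\<rho>'. pf_sat P2 \<rho>' \<psi> \<longrightarrow> (\<forall>\<phi>\<in>A. pf_sat P2 \<rho>' \<phi> \<longleftrightarrow> pf_sat P1 \<rho> \<phi>))"
    using assms(2-4)
  proof (induction A rule: finite_induct)
    case empty
    show ?case by (rule exI[of _ "PEq POne POne"]) simp
  next
    case (insert \<phi> A)
    then obtain \<psi> where "pf_vars \<psi> \<subseteq> {..<n}" "pf_consts \<psi> \<subseteq> Syms S" "pf_sat P1 \<rho> \<psi>"
      "\<forall>\<rho>'. pf_sat P2 \<rho>' \<psi> \<longrightarrow> (\<forall>\<phi>\<in>A. pf_sat P2 \<rho>' \<phi> \<longleftrightarrow> pf_sat P1 \<rho> \<phi>)"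
      by auto
    \<comment> \<open>Each formula enters with the sign it has under \<rho>, so a realisation in
      \<open>P2\<close> reproduces every truth value.\<close>
    then show ?case using insert.prems
      by (intro exI[of _ "PAnd (if pf_sat P1 \<rho> \<phi> then \<phi> else PNot \<phi>) \<psi>"]) simp
  qed
  then obtain \<psi> where \<psi>: "pf_vars \<psi> \<subseteq> {..<n}" "pf_consts \<psi> \<subseteq> Syms S" "pf_sat P1 \<rho> \<psi>"
    "\<And>\<rho>'. pf_sat P2 \<rho>' \<psi> \<Longrightarrow> \<forall>\<phi>\<in>A. pf_sat P2 \<rho>' \<phi> \<longleftrightarrow> pf_sat P1 \<rho> \<phi>"
    by blast
  then have "pre_ex_sat P2 n \<psi>"
    using assms(1,5) unfolding pre_ex_equiv_def pre_ex_sat_def by blast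
  then show ?thesis using \<psi>(4) by (auto simp: pre_ex_sat_def)
qed

lemma diagram_map_exists:
  assumes "pre_ex_equiv S P1 P2" "finite K" "K \<subseteq> Syms S" "finite F" "F \<subseteq> pcarrier P1"
  shows "\<exists>f. diagram_map P1 P2 K F f"
proof -
  obtain xs where xs: "set xs = F" using assms(4) finite_list by blast
  let ?N = "{..<length xs}"
  \<comment> \<open>The atomic formulas behind \<open>diagram_map\<close>, with variable i standing
    for the i-th letter of \<open>xs\<close>; there are finitely many because \<open>F\<close> and
    \<open>K\<close> are finite.\<close>
  let ?A = "(\<lambda>(i, j). PEq (PVar i) (PVar j)) ` (?N \<times> ?N)
    \<union> (\<lambda>(i, j). PDrel (PVar i) (PVar j)) ` (?N \<times> ?N)
    \<union> (\<lambda>(i, j, k). PMrel (PVar i) (PVar j) (PVar k)) ` (?N \<times> ?N \<times> ?N)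
    \<union> (\<lambda>(i, j). PEq (PInv (PVar i)) (PVar j)) ` (?N \<times> ?N)
    \<union> (\<lambda>i. PEq (PVar i) POne) ` ?N
    \<union> (\<lambda>(i, c). PEq (PVar i) (PConst c)) ` (?N \<times> K)
    \<union> (\<lambda>i. PDelta (PVar i)) ` ?N"
  have fin: "finite ?A" using assms(2) by simp
  have syms: "pf_vars \<phi> \<subseteq> ?N" "pf_consts \<phi> \<subseteq> Syms S" if "\<phi> \<in> ?A" for \<phi>
    using that assms(3) by auto
  have car: "(\<lambda>i. xs ! i) ` ?N \<subseteq> pcarrier P1" using assms(5) xs by force
  have "\<exists>\<rho>'. \<rho>' ` ?N \<subseteq> pcarrier P2 \<and>
      (\<forall>\<phi>\<in>?A. pf_sat P2 \<rho>' \<phi> \<longleftrightarrow> pf_sat P1 (\<lambda>i. xs ! i) \<phi>)"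
    using assms(1) fin syms car by (rule pre_ex_equiv_finite)
  then obtain \<rho> where \<rho>: "\<rho> ` ?N \<subseteq> pcarrier P2"
    "\<forall>\<phi>\<in>?A. pf_sat P2 \<rho> \<phi> \<longleftrightarrow> pf_sat P1 (\<lambda>i. xs ! i) \<phi>"
    by (elim exE conjE)
  have "\<forall>x\<in>F. \<exists>i. i < length xs \<and> xs ! i = x" using xs by (auto simp: in_set_conv_nth)
  then obtain g where g: "\<And>x. x \<in> F \<Longrightarrow> g x < length xs" "\<And>x. x \<in> F \<Longrightarrow> xs ! g x = x" by metis
  have "diagram_map P1 P2 K F (\<rho> \<circ> g)"
    using \<rho> g unfolding diagram_map_def by (simp add: ball_Un image_subset_iff)
  then show ?thesis by blast
qed

section \<open>Letter maps carrying words, reductions and formulas\<close>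

locale spre_pair = A: spre_struct P1 K + B: spre_struct P2 K
  for P1 :: "('a, 'c) spre" and P2 :: "('b, 'c) spre" and K :: "'c set"
begin

abbreviation "dmap \<equiv> diagram_map P1 P2 K"

lemma dmap_words: "dmap F f \<Longrightarrow> set u \<subseteq> F \<Longrightarrow> u \<in> A.words \<Longrightarrow> map f u \<in> B.words"
  by (auto simp: A.words_def B.words_def diagram_map_def)

lemma dmap_red_step:
  assumes "dmap F f" "set u \<union> set v \<subseteq> F" "red_step P1 u v"
  shows "red_step P2 (map f u) (map f v)"
proof -
  obtain xs a b c ys where u: "pM P1 a b c" "u = xs @ a # b # ys" "v = xs @ c # ys"
    using assms(3) by (auto simp: A.red_step_iff)
  then have "pM P2 (f a) (f b) (f c)" using assms(1,2) by (simp add: diagram_map_def)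
  then show ?thesis using u B.red_stepI by simp
qed

lemma dmap_reduced:
  assumes "dmap F f" "set w \<subseteq> F"
  shows "reduced P2 (map f w) \<longleftrightarrow> reduced P1 w"
proof -
  have "pD P2 (f (w ! i)) (f (w ! Suc i)) \<longleftrightarrow> pD P1 (w ! i) (w ! Suc i)" if "Suc i < length w" for i
    using assms that by (simp add: diagram_map_def subset_iff)
  then show ?thesis by (auto simp: reduced_def)
qed

text \<open>\<open>F\<close> collects the letters of all words in the chosen reduction
  sequence.\<close>

lemma red_rtranclp_transfer:
  assumes "(red_step P1)\<^sup>*\<^sup>* u w" "u \<in> A.words"
  shows "\<exists>F. finite F \<and> F \<subseteq> pcarrier P1 \<and> set w \<subseteq> F \<and>
    (\<forall>f. dmap F f \<longrightarrow> (red_step P2)\<^sup>*\<^sup>* (map f u) (map f w))"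
  using assms(1)
proof (induction rule: rtranclp_induct)
  case base
  show ?case using assms(2) by (intro exI[of _ "set u"]) (auto simp: A.words_def)
next
  case (step v w)
  then obtain F where F: "finite F" "F \<subseteq> pcarrier P1" "set v \<subseteq> F"
    "\<And>f. dmap F f \<Longrightarrow> (red_step P2)\<^sup>*\<^sup>* (map f u) (map f v)" by blast
  have "w \<in> A.words"
    using step(1,2) assms(2) A.words_red_rtranclp rtranclp.rtrancl_into_rtrancl by metis
  then have w: "set w \<subseteq> pcarrier P1" by (simp add: A.words_def)
  have "(red_step P2)\<^sup>*\<^sup>* (map f u) (map f w)" if f: "dmap (F \<union> set w) f" for f
  proof -
    have "(red_step P2)\<^sup>*\<^sup>* (map f u) (map f v)"
      using F(4) diagram_map_subset[OF f] by simp
    moreover have "red_step P2 (map f v) (map f w)"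
      using dmap_red_step[OF f _ step(2)] F(3) by blast
    ultimately show ?thesis by (rule rtranclp.rtrancl_into_rtrancl)
  qed
  then show ?case using F w by (intro exI[of _ "F \<union> set w"]) simp
qed

lemma tword_transfer:
  assumes "gt_consts t \<subseteq> K" "\<forall>i\<in>gt_vars t. \<omega> i \<in> A.words"
  shows "\<exists>F. finite F \<and> F \<subseteq> pcarrier P1 \<and>
    (\<forall>f. dmap F f \<longrightarrow> map f (tword P1 \<omega> t) = tword P2 (\<lambda>i. map f (\<omega> i)) t)"
  using assms
proof (induction t)
  case (GVar i)
  show ?case by (intro exI[of _ "{}"]) simp
next
  case (GConst c)
  then show ?case
    using A.sconst_closed by (intro exI[of _ "{sconst P1 c}"]) (simp add: diagram_map_def)
next
  case (GMul s t)
  then obtain F G where "finite F" "F \<subseteq> pcarrier P1" "finite G" "G \<subseteq> pcarrier P1"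
    and "\<And>f. dmap F f \<Longrightarrow> map f (tword P1 \<omega> s) = tword P2 (\<lambda>i. map f (\<omega> i)) s"
    and "\<And>f. dmap G f \<Longrightarrow> map f (tword P1 \<omega> t) = tword P2 (\<lambda>i. map f (\<omega> i)) t"
    by auto
  then show ?case
    by (intro exI[of _ "F \<union> G"]) (simp add: diagram_map_subset[where F = "F \<union> G"])
next
  case (GInv t)
  then obtain F where F: "finite F" "F \<subseteq> pcarrier P1"
    "\<And>f. dmap F f \<Longrightarrow> map f (tword P1 \<omega> t) = tword P2 (\<lambda>i. map f (\<omega> i)) t"
    by auto
  \<comment> \<open>Letters and their inverses must both lie in the set, since a diagram map relates
    inverses only within it.\<close>
  let ?u = "tword P1 \<omega> t" and ?G = "F \<union> set (tword P1 \<omega> t) \<union> set (tword P1 \<omega> (GInv t))"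
  have u: "set ?u \<subseteq> pcarrier P1"
    using GInv.prems A.tword_words[of t \<omega>] by (simp add: A.words_def)
  have "map f (tword P1 \<omega> (GInv t)) = tword P2 (\<lambda>i. map f (\<omega> i)) (GInv t)" if f: "dmap ?G f" for f
  proof -
    have "pinv P2 (f x) = f (pinv P1 x)" if "x \<in> set ?u" for x
      using f that unfolding diagram_map_def by simp
    moreover have "tword P2 (\<lambda>i. map f (\<omega> i)) t = map f ?u"
      by (rule F(3)[symmetric], rule diagram_map_subset[OF f]) blast
    ultimately show ?thesis by (simp add: rev_map)
  qed
  moreover have "finite ?G" "?G \<subseteq> pcarrier P1" using F u A.inv_closed by auto
  ultimately show ?case by (intro exI[of _ ?G] conjI allI impI)
qed

text \<open>Because \<open>D\<close> is also reflected, the image of a reduced word is reduced. Thus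
  the image is a normal form, and this is what decides atoms that fail as well as atoms that
  hold.\<close>

lemma normal_form_transfer:
  assumes "gt_consts t \<subseteq> K" "\<forall>i\<in>gt_vars t. \<omega> i \<in> A.words" "A.normal_form (tword P1 \<omega> t) w"
  shows "\<exists>F. finite F \<and> F \<subseteq> pcarrier P1 \<and> set w \<subseteq> F \<and>
    (\<forall>f. dmap F f \<longrightarrow> B.normal_form (tword P2 (\<lambda>i. map f (\<omega> i)) t) (map f w))"
proof -
  obtain F where F: "finite F" "F \<subseteq> pcarrier P1"
    "\<And>f. dmap F f \<Longrightarrow> map f (tword P1 \<omega> t) = tword P2 (\<lambda>i. map f (\<omega> i)) t"
    using tword_transfer[OF assms(1,2)] by (elim exE conjE) blast
  obtain G where G: "finite G" "G \<subseteq> pcarrier P1" "set w \<subseteq> G"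
    "\<And>f. dmap G f \<Longrightarrow> (red_step P2)\<^sup>*\<^sup>* (map f (tword P1 \<omega> t)) (map f w)"
    using red_rtranclp_transfer[OF _ A.tword_words[OF assms(1,2)], of w] assms(3)
    by (auto simp: A.normal_form_def)
  have "B.normal_form (tword P2 (\<lambda>i. map f (\<omega> i)) t) (map f w)" if f: "dmap (F \<union> G) f" for f
  proof -
    have "dmap F f" "dmap G f" using f diagram_map_subset by blast+
    then show ?thesis
      using F(3) G(4) dmap_reduced[OF _ G(3)] assms(3)
      unfolding A.normal_form_def B.normal_form_def by metis
  qed
  then show ?thesis using F G by (intro exI[of _ "F \<union> G"]) auto
qed

text \<open>Stating an equivalence makes negation immediate, and binary connectives take the union
  of the two sets.\<close>

lemma gf_sat_transfer:
  assumes "gf_consts \<phi> \<subseteq> K" "\<forall>i\<in>gf_vars \<phi>. \<omega> i \<in> A.words \<and> \<rho> i = A.cls (\<omega> i)"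
  shows "\<exists>F. finite F \<and> F \<subseteq> pcarrier P1 \<and>
    (\<forall>f. dmap F f \<longrightarrow> (\<forall>i\<in>gf_vars \<phi>. map f (\<omega> i) \<in> B.words) \<longrightarrow>
      (gf_sat (Ugroup P2) (\<lambda>i. B.cls (map f (\<omega> i))) \<phi> \<longleftrightarrow> gf_sat (Ugroup P1) \<rho> \<phi>))"
  using assms
proof (induction \<phi>)
  case (GEq s t)
  let ?t = "GMul s (GInv t)"
  obtain w where w: "A.normal_form (tword P1 \<omega> ?t) w" using A.normal_form_exists by blast
  obtain F where F: "finite F" "F \<subseteq> pcarrier P1" "set w \<subseteq> F"
    "\<And>f. dmap F f \<Longrightarrow> B.normal_form (tword P2 (\<lambda>i. map f (\<omega> i)) ?t) (map f w)"
    using normal_form_transfer[OF _ _ w] GEq by auto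
  have "gf_sat (Ugroup P2) (\<lambda>i. B.cls (map f (\<omega> i))) (GEq s t) \<longleftrightarrow> gf_sat (Ugroup P1) \<rho> (GEq s t)"
    if f: "dmap F f" "\<forall>i\<in>gf_vars (GEq s t). map f (\<omega> i) \<in> B.words" for f
  proof -
    have "gf_sat (Ugroup P2) (\<lambda>i. B.cls (map f (\<omega> i))) (GEq s t) \<longleftrightarrow> map f w = [pone P2]"
      using B.gf_sat_GEq_iff[OF _ _ _ F(4)[OF f(1)]] f(2) GEq.prems by simp
    \<comment> \<open>\<open>map\<close> keeps the length, and among letters of \<open>F\<close>
      only 1 is sent to 1.\<close>
    also have "\<dots> \<longleftrightarrow> w = [pone P1]"
      using f(1) F(3) by (cases w) (auto simp: diagram_map_def)
    also have "\<dots> \<longleftrightarrow> gf_sat (Ugroup P1) \<rho> (GEq s t)"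
      using A.gf_sat_GEq_iff[OF _ _ _ w] GEq.prems by simp
    finally show ?thesis .
  qed
  then show ?case using F(1,2) by (intro exI[of _ F] conjI allI impI)
next
  case (GDelta t)
  obtain w where w: "A.normal_form (tword P1 \<omega> t) w" using A.normal_form_exists by blast
  obtain F where F: "finite F" "F \<subseteq> pcarrier P1" "set w \<subseteq> F"
    "\<And>f. dmap F f \<Longrightarrow> B.normal_form (tword P2 (\<lambda>i. map f (\<omega> i)) t) (map f w)"
    using normal_form_transfer[OF _ _ w] GDelta by auto
  have "gf_sat (Ugroup P2) (\<lambda>i. B.cls (map f (\<omega> i))) (GDelta t) \<longleftrightarrow> gf_sat (Ugroup P1) \<rho> (GDelta t)"
    if f: "dmap F f" "\<forall>i\<in>gf_vars (GDelta t). map f (\<omega> i) \<in> B.words" for f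
  proof -
    have "gf_sat (Ugroup P2) (\<lambda>i. B.cls (map f (\<omega> i))) (GDelta t) \<longleftrightarrow> (\<exists>y\<in>sdelta P2. map f w = [y])"
      using B.gf_sat_GDelta_iff[OF _ _ F(4)[OF f(1)]] f(2) GDelta.prems by simp
    also have "\<dots> \<longleftrightarrow> (\<exists>x\<in>sdelta P1. w = [x])"
      using f(1) F(3) by (cases w) (auto simp: diagram_map_def)
    also have "\<dots> \<longleftrightarrow> gf_sat (Ugroup P1) \<rho> (GDelta t)"
      using A.gf_sat_GDelta_iff[OF _ _ w] GDelta.prems by simp
    finally show ?thesis .
  qed
  then show ?case using F(1,2) by (intro exI[of _ F] conjI allI impI)
next
  case (GNot \<phi>)
  then show ?case by simp
next
  case (GAnd \<phi> \<psi>)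
  let ?\<rho> = "\<lambda>f i. B.cls (map f (\<omega> i))"
  obtain F G where "finite F" "F \<subseteq> pcarrier P1" "finite G" "G \<subseteq> pcarrier P1"
    and "\<And>f. dmap F f \<Longrightarrow> \<forall>i\<in>gf_vars \<phi>. map f (\<omega> i) \<in> B.words \<Longrightarrow>
      gf_sat (Ugroup P2) (?\<rho> f) \<phi> \<longleftrightarrow> gf_sat (Ugroup P1) \<rho> \<phi>"
    "\<And>f. dmap G f \<Longrightarrow> \<forall>i\<in>gf_vars \<psi>. map f (\<omega> i) \<in> B.words \<Longrightarrow>
      gf_sat (Ugroup P2) (?\<rho> f) \<psi> \<longleftrightarrow> gf_sat (Ugroup P1) \<rho> \<psi>"
    using GAnd by (simp add: ball_Un) blast
  then show ?case
    by (intro exI[of _ "F \<union> G"]) (simp add: diagram_map_subset[where F = "F \<union> G"])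
next
  case (GOr \<phi> \<psi>)
  let ?\<rho> = "\<lambda>f i. B.cls (map f (\<omega> i))"
  obtain F G where "finite F" "F \<subseteq> pcarrier P1" "finite G" "G \<subseteq> pcarrier P1"
    and "\<And>f. dmap F f \<Longrightarrow> \<forall>i\<in>gf_vars \<phi>. map f (\<omega> i) \<in> B.words \<Longrightarrow>
      gf_sat (Ugroup P2) (?\<rho> f) \<phi> \<longleftrightarrow> gf_sat (Ugroup P1) \<rho> \<phi>"
    "\<And>f. dmap G f \<Longrightarrow> \<forall>i\<in>gf_vars \<psi>. map f (\<omega> i) \<in> B.words \<Longrightarrow>
      gf_sat (Ugroup P2) (?\<rho> f) \<psi> \<longleftrightarrow> gf_sat (Ugroup P1) \<rho> \<psi>"
    using GOr by (simp add: ball_Un) blast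
  then show ?case
    by (intro exI[of _ "F \<union> G"]) (simp add: diagram_map_subset[where F = "F \<union> G"])
qed

lemma grp_ex_sat_transfer:
  assumes "\<And>F. finite F \<Longrightarrow> F \<subseteq> pcarrier P1 \<Longrightarrow> \<exists>f. dmap F f"
    and "gf_consts \<phi> \<subseteq> K" "gf_vars \<phi> \<subseteq> {..<n}" "grp_ex_sat (Ugroup P1) n \<phi>"
  shows "grp_ex_sat (Ugroup P2) n \<phi>"
proof -
  obtain \<rho> where \<rho>: "\<rho> ` {..<n} \<subseteq> A.cls ` A.words" "gf_sat (Ugroup P1) \<rho> \<phi>"
    using assms(4) by (auto simp: grp_ex_sat_def Ugroup_def A.Ucarrier_eq)
  then have "\<forall>i\<in>{..<n}. \<exists>u. u \<in> A.words \<and> \<rho> i = A.cls u" by blast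
  then obtain \<omega> where \<omega>: "\<And>i. i < n \<Longrightarrow> \<omega> i \<in> A.words \<and> \<rho> i = A.cls (\<omega> i)"
    by (metis lessThan_iff)
  then obtain F where F: "finite F" "F \<subseteq> pcarrier P1"
    "\<And>f. dmap F f \<Longrightarrow> \<forall>i\<in>gf_vars \<phi>. map f (\<omega> i) \<in> B.words \<Longrightarrow>
      gf_sat (Ugroup P2) (\<lambda>i. B.cls (map f (\<omega> i))) \<phi> \<longleftrightarrow> gf_sat (Ugroup P1) \<rho> \<phi>"
    using gf_sat_transfer[OF assms(2), of \<omega> \<rho>] assms(3) by (meson lessThan_iff subsetD)
  \<comment> \<open>The letters of the assigned words are added so that their images are words over
    \<open>P2\<close>.\<close>
  let ?G = "F \<union> (\<Union>i<n. set (\<omega> i))"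
  have "finite ?G" "?G \<subseteq> pcarrier P1" using F \<omega> by (auto simp: A.words_def)
  then obtain f where f: "dmap ?G f" using assms(1) by blast
  have words: "map f (\<omega> i) \<in> B.words" if "i < n" for i
    using dmap_words[OF f, of "\<omega> i"] \<omega> that by blast
  have "dmap F f" using diagram_map_subset[OF f] by simp
  then have "gf_sat (Ugroup P2) (\<lambda>i. B.cls (map f (\<omega> i))) \<phi>"
    using F(3) \<rho>(2) words assms(3) by blast
  moreover have "(\<lambda>i. B.cls (map f (\<omega> i))) ` {..<n} \<subseteq> gcarrier (Ugroup P2)"
    using words by (auto simp: Ugroup_def B.Ucarrier_eq)
  ultimately show ?thesis unfolding grp_ex_sat_def by blast
qed

end

lemma spregroup_spre_struct: "spregroup Q S P \<Longrightarrow> K \<subseteq> Syms S \<Longrightarrow> spre_struct P K"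
  unfolding spregroup_def spre_struct_def spre_struct_axioms_def pregroup_struct_def by blast

lemma finite_gf_consts: "finite (gf_consts \<phi>)"
proof -
  have "finite (gt_consts t)" for t :: "'c gterm" by (induction t) auto
  then show ?thesis by (induction \<phi>) auto
qed

lemma grp_ex_sat_Ugroup_transfer:
  assumes "spregroup Q S P1" "spregroup Q S P2" "pre_ex_equiv S P1 P2"
    and "gf_vars \<phi> \<subseteq> {..<n}" "gf_consts \<phi> \<subseteq> Syms S" "grp_ex_sat (Ugroup P1) n \<phi>"
  shows "grp_ex_sat (Ugroup P2) n \<phi>"
proof -
  \<comment> \<open>Restricting to the constants of \<phi> keeps the diagrams finite.\<close>
  interpret spre_pair P1 P2 "gf_consts \<phi>"
    unfolding spre_pair_def using assms by (blast intro: spregroup_spre_struct)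
  show ?thesis
    using grp_ex_sat_transfer[OF diagram_map_exists[OF assms(3) finite_gf_consts assms(5)] _ assms(4,6)]
    by blast
qed

theorem mainTheorem5:
  fixes Q :: "'q pregroup" and S :: "'q set set"
    and P1 :: "('a, 'q set \<times> 'q) spre" and P2 :: "('b, 'q set \<times> 'q) spre"
  assumes "pregroup Q"
    and "\<forall>K\<in>S. K \<subseteq> pcarrier Q \<and> pone Q \<in> K"
    and "spregroup Q S P1" and "spregroup Q S P2"
    and "pre_ex_equiv S P1 P2"
  shows "grp_ex_equiv S (Ugroup P1) (Ugroup P2)"
  unfolding grp_ex_equiv_def
  using grp_ex_sat_Ugroup_transfer[OF assms(3-5)]
    grp_ex_sat_Ugroup_transfer[OF assms(4,3) pre_ex_equiv_sym[OF assms(5)]] by blast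

end
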